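(* Let $A,B\in\mathbb{B}(\mathscr{H})_+$, $X\in\mathcal{I}$ and $1/4\leq\nu\leq 3/4$. Put $r_0=\min\{\nu,1-\nu\}$ and $\lambda_{\min}=\min\{2-4r_0,\,4r_0-1\}$. Then $$K(\nu)\leq K(\nu)+2\lambda_{\min}\left(\frac12K(1/4)-K(3/8)\right)\leq 2(1-2r_0)K(1/4).$$
   Context: $\mathscr{H}$ is a separable complex Hilbert space, $\mathbb{B}(\mathscr{H})_+$ is the cone of positive (semidefinite) bounded operators on $\mathscr{H}$, and $\mathbb{K}(\mathscr{H})$ is the ideal of compact operators. A unitarily invariant norm $|||\cdot|||:\mathbb{K}(\mathscr{H})\to[0,\infty]$ is a map $|||A|||=g(s(A))$, where $g$ is a symmetric gauge function and $s(A)=(s_1(A),s_2(A),\dots)$ is the sequence of singular values of $A$ (eigenvalues of $|A|=(A^*A)^{1/2}$ in decreasing order with multiplicity). Fix such a norm and put $\mathcal{I}=\{A\in\mathbb{K}(\mathscr{H}):|||A|||<\infty\}$, a two-sided ideal of $\mathbb{B}(\mathscr{H})$. For given $A,B,X$ define, for $\nu\in[0,1]$, $$K(\nu)=|||A^{\nu}XB^{1-\nu}-A^{1-\nu}XB^{\nu}|||.$$ *)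

theory Defs
  imports "HOL-Analysis.Analysis" "HOL-Computational_Algebra.Polynomial"
begin

section \<open>Complex Hilbert spaces\<close>

class scaleC =
  fixes scaleC :: "complex \<Rightarrow> 'a \<Rightarrow> 'a"  (infixr "*\<^sub>C" 75)

text \<open>The inner product is linear in its first argument.\<close>

class complex_inner = real_normed_vector + scaleC +
  fixes cinner :: "'a \<Rightarrow> 'a \<Rightarrow> complex"
  assumes scaleC_add_right: "a *\<^sub>C (x + y) = a *\<^sub>C x + a *\<^sub>C y"
    and scaleC_add_left: "(a + b) *\<^sub>C x = a *\<^sub>C x + b *\<^sub>C x"
    and scaleC_scaleC: "a *\<^sub>C b *\<^sub>C x = (a * b) *\<^sub>C x"
    and scaleC_one: "1 *\<^sub>C x = x"
    and scaleR_scaleC: "r *\<^sub>R x = complex_of_real r *\<^sub>C x"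
    and cinner_add_left: "cinner (x + y) z = cinner x z + cinner y z"
    and cinner_scaleC_left: "cinner (a *\<^sub>C x) y = a * cinner x y"
    and cinner_commute: "cinner x y = cnj (cinner y x)"
    and cinner_self: "cinner x x = complex_of_real ((norm x)\<^sup>2)"

class separable_hilbert = complex_inner + complete_space +
  assumes separable: "\<exists>D. countable D \<and> (\<forall>U. open U \<longrightarrow> U \<noteq> {} \<longrightarrow> (\<exists>d\<in>D. d \<in> U))"

lemma vector_space_scaleC:
  "vector_space (scaleC :: complex \<Rightarrow> 'a \<Rightarrow> 'a :: complex_inner)"
  by unfold_locales (simp_all add: scaleC_add_right scaleC_add_left scaleC_scaleC scaleC_one)

definition cdim :: "'a :: complex_inner set \<Rightarrow> nat" where
  "cdim V = vector_space.dim scaleC V"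

instantiation complex :: separable_hilbert
begin

definition scaleC_complex :: "complex \<Rightarrow> complex \<Rightarrow> complex" where
  "scaleC_complex a x = a * x"

definition cinner_complex :: "complex \<Rightarrow> complex \<Rightarrow> complex" where
  "cinner_complex x y = x * cnj y"

instance
proof
  show "\<exists>D :: complex set. countable D \<and> (\<forall>U. open U \<longrightarrow> U \<noteq> {} \<longrightarrow> (\<exists>d\<in>D. d \<in> U))"
    by (rule countable_dense_exists)
qed (auto simp: scaleC_complex_def cinner_complex_def algebra_simps scaleR_conv_of_real
      complex_norm_square [symmetric])

end


section \<open>Bounded operators\<close>

text \<open>The type of bounded real-linear maps supplies the algebra operations and the operator
  norm; the bounded operators on the complex Hilbert space are its complex-linear elements.\<close>

definition is_clinear :: "('a :: complex_inner \<Rightarrow>\<^sub>L 'a) \<Rightarrow> bool" where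
  "is_clinear A \<longleftrightarrow> (\<forall>c x. blinfun_apply A (c *\<^sub>C x) = c *\<^sub>C blinfun_apply A x)"

definition positive_op :: "('a :: complex_inner \<Rightarrow>\<^sub>L 'a) \<Rightarrow> bool" where
  "positive_op A \<longleftrightarrow> is_clinear A \<and>
     (\<forall>x. cinner (blinfun_apply A x) x \<in> \<real> \<and> 0 \<le> Re (cinner (blinfun_apply A x) x))"

definition compact_op :: "('a :: complex_inner \<Rightarrow>\<^sub>L 'a) \<Rightarrow> bool" where
  "compact_op A \<longleftrightarrow> is_clinear A \<and> compact (closure (blinfun_apply A ` cball 0 1))"

definition adj :: "('a :: complex_inner \<Rightarrow>\<^sub>L 'a) \<Rightarrow> ('a \<Rightarrow>\<^sub>L 'a)" where
  "adj A = (THE B. \<forall>x y. cinner (blinfun_apply A x) y = cinner x (blinfun_apply B y))"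

definition poly_op :: "real poly \<Rightarrow> ('a :: real_normed_vector \<Rightarrow>\<^sub>L 'a) \<Rightarrow> ('a \<Rightarrow>\<^sub>L 'a)" where
  "poly_op p A = (\<Sum>i\<le>degree p. coeff p i *\<^sub>R ((\<lambda>B. A o\<^sub>L B) ^^ i) id_blinfun)"

text \<open>The power \<open>A\<^sup>r\<close> (\<open>r \<ge> 0\<close>) of a positive operator by continuous functional calculus: the
  spectrum of \<open>A\<close> lies in \<open>[0, \<parallel>A\<parallel>]\<close>, and \<open>A\<^sup>r\<close> is the norm limit of \<open>p\<^sub>n(A)\<close> for every sequence of
  polynomials \<open>p\<^sub>n\<close> converging to \<open>t\<^sup>r\<close> uniformly on that interval. The case distinction gives
  \<open>A\<^sup>0 = I\<close>, as \<open>0 powr 0 = 0\<close> in the library.\<close>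

definition op_powr :: "('a :: complex_inner \<Rightarrow>\<^sub>L 'a) \<Rightarrow> real \<Rightarrow> ('a \<Rightarrow>\<^sub>L 'a)" where
  "op_powr A r = (THE T. \<forall>p :: nat \<Rightarrow> real poly.
     uniform_limit {0..norm A} (\<lambda>n t. poly (p n) t) (\<lambda>t. if r = 0 then 1 else t powr r) sequentially
       \<longrightarrow> (\<lambda>n. poly_op (p n) A) \<longlonglongrightarrow> T)"

definition abs_op :: "('a :: complex_inner \<Rightarrow>\<^sub>L 'a) \<Rightarrow> ('a \<Rightarrow>\<^sub>L 'a)" where
  "abs_op A = op_powr (adj A o\<^sub>L A) (1/2)"


section \<open>Unitarily invariant norms\<close>

text \<open>For compact \<open>A\<close>, the eigenvalues of \<open>|A|\<close> in decreasing order: each positive eigenvalue is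
  listed as often as its multiplicity, and if there are only finitely many of them the sequence is
  continued by zeros. (Indices start at 0.)\<close>

definition singular_values :: "('a :: complex_inner \<Rightarrow>\<^sub>L 'a) \<Rightarrow> nat \<Rightarrow> real" where
  "singular_values A = (THE s. decseq s \<and> (\<forall>n. 0 \<le> s n) \<and>
     (\<forall>l>0. finite {n. s n = l} \<and>
        card {n. s n = l} = cdim {x. blinfun_apply (abs_op A) x = l *\<^sub>R x}))"

definition finitely_supported :: "(nat \<Rightarrow> real) \<Rightarrow> bool" where
  "finitely_supported s \<longleftrightarrow> finite {i. s i \<noteq> 0}"

text \<open>A symmetric gauge function is a permutation and sign invariant norm on the finitely
  supported real sequences; its values on other arguments are irrelevant.\<close>

definition symmetric_gauge :: "((nat \<Rightarrow> real) \<Rightarrow> real) \<Rightarrow> bool" where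
  "symmetric_gauge g \<longleftrightarrow>
     (\<forall>s. finitely_supported s \<longrightarrow> 0 \<le> g s \<and> (g s = 0 \<longleftrightarrow> s = (\<lambda>i. 0))) \<and>
     (\<forall>s c. finitely_supported s \<longrightarrow> g (\<lambda>i. c * s i) = \<bar>c\<bar> * g s) \<and>
     (\<forall>s t. finitely_supported s \<longrightarrow> finitely_supported t \<longrightarrow> g (\<lambda>i. s i + t i) \<le> g s + g t) \<and>
     (\<forall>s \<pi>. finitely_supported s \<longrightarrow> bij \<pi> \<longrightarrow> g (\<lambda>i. s (\<pi> i)) = g s) \<and>
     (\<forall>s \<epsilon>. finitely_supported s \<longrightarrow> (\<forall>i. \<epsilon> i \<in> {-1, 1}) \<longrightarrow> g (\<lambda>i. \<epsilon> i * s i) = g s)"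

text \<open>The extension of a symmetric gauge function to arbitrary sequences, with values in
  \<open>[0, \<infinity>]\<close>.\<close>

definition gauge_ext :: "((nat \<Rightarrow> real) \<Rightarrow> real) \<Rightarrow> (nat \<Rightarrow> real) \<Rightarrow> ereal" where
  "gauge_ext g s = (SUP n. ereal (g (\<lambda>i. if i < n then s i else 0)))"

definition ui_norm :: "((nat \<Rightarrow> real) \<Rightarrow> real) \<Rightarrow> ('a :: complex_inner \<Rightarrow>\<^sub>L 'a) \<Rightarrow> ereal" where
  "ui_norm g A = gauge_ext g (singular_values A)"

definition norm_ideal :: "((nat \<Rightarrow> real) \<Rightarrow> real) \<Rightarrow> ('a :: complex_inner \<Rightarrow>\<^sub>L 'a) set" where
  "norm_ideal g = {A. compact_op A \<and> ui_norm g A < \<infinity>}"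

definition heinz_diff ::
  "((nat \<Rightarrow> real) \<Rightarrow> real) \<Rightarrow> ('a :: complex_inner \<Rightarrow>\<^sub>L 'a) \<Rightarrow> ('a \<Rightarrow>\<^sub>L 'a) \<Rightarrow> ('a \<Rightarrow>\<^sub>L 'a) \<Rightarrow> real \<Rightarrow> ereal"
  where
  "heinz_diff g A B X \<nu> =
     ui_norm g ((op_powr A \<nu> o\<^sub>L X o\<^sub>L op_powr B (1 - \<nu>)) - (op_powr A (1 - \<nu>) o\<^sub>L X o\<^sub>L op_powr B \<nu>))"

end

theory Submission
  imports Defs
begin

text \<open>
  The function \<open>K\<close> is symmetric about \<open>1/2\<close>, vanishes at \<open>1/2\<close>, and is finite and convex on
  \<open>[0, 1]\<close>; the two inequalities are properties of every such function. By symmetry \<open>\<nu>\<close> may be replaced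
  by \<open>r\<^sub>0 \<in> [1/4, 1/2]\<close>. Since \<open>3/8\<close> is the midpoint of \<open>1/4\<close> and \<open>1/2\<close>, convexity gives
  \<open>K(3/8) \<le> K(1/4)/2\<close>, which is the first inequality. For the second one, \<open>K(r\<^sub>0)\<close> is bounded by the
  chord over \<open>[1/4, 3/8]\<close> or over \<open>[3/8, 1/2]\<close>; the coefficient \<open>2 \<lambda>\<^sub>m\<^sub>i\<^sub>n\<close> is the weight that this chord
  gives to \<open>K(3/8)\<close>, so that these terms cancel.

  Convexity. A bounded midpoint convex function lies below its chords
  (\<open>midpoint_convex_bounded_le_chord\<close>), so it suffices to compare \<open>K\<close> at \<open>x\<close>, \<open>y\<close> and their midpoint.
  Let \<open>\<delta> = (y - x)/2\<close>, \<open>a = A\<^sup>\<delta>\<close>, \<open>b = B\<^sup>\<delta>\<close> and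
  \<open>Y = A\<^sup>x X B\<^sup>1\<^sup>-\<^sup>y - A\<^sup>1\<^sup>-\<^sup>y X B\<^sup>x\<close>. Then \<open>aYb\<close> is the operator whose norm is \<open>K((x+y)/2)\<close>, and
  \<open>a\<^sup>2Y + Yb\<^sup>2\<close> is the sum of the operators that belong to \<open>x\<close> and \<open>y\<close>. The claim is therefore the
  operator arithmetic-geometric mean inequality \<open>2|||aYb||| \<le> |||a\<^sup>2Y + Yb\<^sup>2|||\<close>
  (\<open>arithmetic_geometric_mean_ui_norm\<close>) together with the triangle inequality.

  The mean inequality. Let \<open>s\<^sub>k, v\<^sub>k, u\<^sub>k\<close> be the singular values and Schmidt vectors of \<open>Z = aYb\<close>. On
  \<open>H \<oplus> H\<close> the operator \<open>M(p, q) = (a\<^sup>2Yq, b\<^sup>2Y\<^sup>*p)\<close> has the eigenvectors \<open>(au\<^sub>k, bv\<^sub>k)\<close> with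
  eigenvalues \<open>s\<^sub>k\<close>. Orthonormalising them makes \<open>M\<close> triangular with the same diagonal
  (\<open>triangularizing_orthonormal_basis\<close>), which yields an orthonormal system of pairs \<open>(p\<^sub>k, q\<^sub>k)\<close> with
  \<open>s\<^sub>k = Re \<langle>M(p\<^sub>k, q\<^sub>k), (p\<^sub>k, q\<^sub>k)\<rangle> = Re \<langle>(a\<^sup>2Y + Yb\<^sup>2)q\<^sub>k, p\<^sub>k\<rangle>\<close>. A sharp form of Ky Fan's maximum principle
  for systems that are orthonormal in \<open>H \<oplus> H\<close> (\<open>Ky_Fan_pairs\<close>) bounds twice the sum of these numbers by
  the sum of the largest singular values of \<open>a\<^sup>2Y + Yb\<^sup>2\<close>.

  The norm. All statements about \<open>|||\<cdot>|||\<close> are reduced to partial sums of singular values by Fan's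
  dominance principle for symmetric gauge functions (\<open>Fan_dominance\<close>). The singular value sequence of
  a compact operator is identified with the one that arises from successive maximisation of \<open>\<parallel>Tx\<parallel>\<close>
  (\<open>singular_values_eq\<close>), and powers of positive operators obey \<open>A\<^sup>r\<^sup>+\<^sup>s = A\<^sup>rA\<^sup>s\<close> because
  \<open>\<parallel>p(A)\<parallel>\<close> is at most the supremum of \<open>|p|\<close> on \<open>[0, \<parallel>A\<parallel>]\<close> for polynomials \<open>p\<close> (\<open>norm_poly_op_le\<close>).
\<close>

section \<open>Inner products and adjoints\<close>

instance separable_hilbert \<subseteq> banach ..

lemma cinner_add_right: "cinner x (y + z) = cinner x y + cinner x (z :: 'a :: complex_inner)"
  by (metis cinner_commute cinner_add_left complex_cnj_add)

lemma cinner_scaleC_right: "cinner x (a *\<^sub>C y) = cnj a * cinner x (y :: 'a :: complex_inner)"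
  by (metis cinner_commute cinner_scaleC_left complex_cnj_mult)

lemma cinner_scaleR_left [simp]: "cinner (r *\<^sub>R x) y = of_real r * cinner x (y :: 'a :: complex_inner)"
  by (simp add: scaleR_scaleC cinner_scaleC_left)

lemma cinner_scaleR_right [simp]: "cinner x (r *\<^sub>R y) = of_real r * cinner x (y :: 'a :: complex_inner)"
  by (simp add: scaleR_scaleC cinner_scaleC_right)

lemma cinner_zero_left [simp]: "cinner 0 (y :: 'a :: complex_inner) = 0"
  using cinner_scaleR_left[of 0 0 y] by simp

lemma cinner_zero_right [simp]: "cinner (y :: 'a :: complex_inner) 0 = 0"
  using cinner_scaleR_right[of y 0 0] by simp

lemma cinner_minus_left [simp]: "cinner (- x) y = - cinner x (y :: 'a :: complex_inner)"
  using cinner_scaleR_left[of "-1" x y] by simp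

lemma cinner_minus_right [simp]: "cinner x (- y) = - cinner x (y :: 'a :: complex_inner)"
  using cinner_scaleR_right[of x "-1" y] by simp

lemma cinner_diff_left: "cinner (x - z) y = cinner x y - cinner z (y :: 'a :: complex_inner)"
  using cinner_add_left[of x "- z" y] by simp

lemma cinner_diff_right: "cinner y (x - z) = cinner y x - cinner y (z :: 'a :: complex_inner)"
  using cinner_add_right[of y x "- z"] by simp

lemma cinner_sum_left: "cinner (\<Sum>i\<in>I. f i) y = (\<Sum>i\<in>I. cinner (f i) (y :: 'a :: complex_inner))"
  by (induction I rule: infinite_finite_induct) (auto simp: cinner_add_left)

lemma cinner_sum_right: "cinner y (\<Sum>i\<in>I. f i) = (\<Sum>i\<in>I. cinner (y :: 'a :: complex_inner) (f i))"
  by (induction I rule: infinite_finite_induct) (auto simp: cinner_add_right)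

lemmas cinner_simps = cinner_add_left cinner_add_right cinner_diff_left cinner_diff_right
  cinner_scaleC_left cinner_scaleC_right

lemma norm_scaleC: "norm (c *\<^sub>C (x :: 'a :: complex_inner)) = cmod c * norm x"
proof -
  have "complex_of_real ((norm (c *\<^sub>C x))\<^sup>2) = complex_of_real ((cmod c * norm x)\<^sup>2)"
    unfolding cinner_self [symmetric] cinner_scaleC_left cinner_scaleC_right
    by (simp add: cinner_self power_mult_distrib mult_ac)
      (metis complex_norm_square of_real_power)
  then show ?thesis
    by (metis norm_ge_zero mult_nonneg_nonneg of_real_eq_iff power2_eq_iff_nonneg)
qed

lemma scaleC_zero_right [simp]: "c *\<^sub>C (0 :: 'a :: complex_inner) = 0"
  using norm_scaleC[of c 0] by simp

lemma norm_sq_eq: "(norm (x :: 'a :: complex_inner))\<^sup>2 = Re (cinner x x)"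
  by (simp add: cinner_self)

lemma Re_cinner_commute: "Re (cinner x y) = Re (cinner y (x :: 'a :: complex_inner))"
  by (subst cinner_commute) simp

lemma cmod_cinner_commute: "cmod (cinner x y) = cmod (cinner y (x :: 'a :: complex_inner))"
  by (subst cinner_commute) simp

lemma norm_sq_add:
  "(norm (x + y))\<^sup>2 = (norm x)\<^sup>2 + 2 * Re (cinner x y) + (norm (y :: 'a :: complex_inner))\<^sup>2"
  by (simp add: norm_sq_eq cinner_simps Re_cinner_commute[of y x])

lemma norm_sq_diff:
  "(norm (x - y))\<^sup>2 = (norm x)\<^sup>2 - 2 * Re (cinner x y) + (norm (y :: 'a :: complex_inner))\<^sup>2"
  by (simp add: norm_sq_eq cinner_simps Re_cinner_commute[of y x])

lemma Re_cinner_le: "Re (cinner x y) \<le> norm x * norm (y :: 'a :: complex_inner)"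
proof (cases "x = 0 \<or> y = 0")
  case False
  then have p: "norm x > 0" "norm y > 0" by auto
  have "0 \<le> (norm (norm y *\<^sub>R x - norm x *\<^sub>R y))\<^sup>2" by simp
  also have "\<dots> = 2 * (norm x * norm y) * (norm x * norm y - Re (cinner x y))"
    unfolding norm_sq_diff by (simp add: power2_eq_square algebra_simps)
  finally have "0 \<le> norm x * norm y - Re (cinner x y)"
    using mult_pos_pos[OF p] by (simp only: zero_le_mult_iff) linarith
  then show ?thesis by simp
qed auto

lemma cmod_cinner_le: "cmod (cinner x y) \<le> norm x * norm (y :: 'a :: complex_inner)"
proof (cases "cinner x y = 0")
  case False
  define c where "c = cnj (cinner x y) / cmod (cinner x y)"
  have c: "cmod c = 1" using False by (simp add: c_def norm_divide)
  have "complex_of_real (cmod (cinner x y)) = c * cinner x y"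
    using False by (simp add: c_def complex_norm_square[symmetric] power2_eq_square field_simps)
  then have "cmod (cinner x y) = Re (cinner (c *\<^sub>C x) y)"
    by (metis Re_complex_of_real cinner_scaleC_left)
  also have "\<dots> \<le> norm (c *\<^sub>C x) * norm y" by (rule Re_cinner_le)
  finally show ?thesis using c by (simp add: norm_scaleC)
qed auto

lemma bounded_linear_cinner_left: "bounded_linear (\<lambda>x. cinner x (y :: 'a :: complex_inner))"
  by (rule bounded_linear_intro[where K = "norm y"])
    (auto simp: cinner_simps cmod_cinner_le scaleR_conv_of_real)

text \<open>For \<open>x = y - z\<close> the difference of the two sides is \<open>\<parallel>y - z\<parallel>\<^sup>2\<close>. The criterion saves separate treatment of
  imaginary parts when an operator is determined by its form.\<close>

lemma cinner_eq_all_Re: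
  assumes "\<And>x. Re (cinner x y) = Re (cinner x z)"
  shows "y = (z :: 'a :: complex_inner)"
proof -
  have "Re (cinner (y - z) (y - z)) = 0" using assms[of "y - z"] by (simp add: cinner_diff_right)
  then have "(norm (y - z))\<^sup>2 = 0" by (simp only: norm_sq_eq)
  then show ?thesis by simp
qed

text \<open>The representing vector is the minimiser of \<open>\<parallel>x\<parallel>\<^sup>2 - 2\<phi>(x)\<close>: a minimising sequence is Cauchy by the
  parallelogram law, and the vanishing derivative at the minimum is the representation. Using a real
  functional and the real part of the inner product covers complex-linear functionals as well.\<close>

lemma Riesz_representation:
  fixes \<phi> :: "'a :: separable_hilbert \<Rightarrow> real"
  assumes "bounded_linear \<phi>"
  shows "\<exists>z. \<forall>x. \<phi> x = Re (cinner x z)"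
proof -
  interpret bounded_linear \<phi> by fact
  obtain C where C: "\<And>x. norm (\<phi> x) \<le> norm x * C" and C0: "C \<ge> 0"
    using nonneg_bounded by blast
  define F where "F x = (norm x)\<^sup>2 - 2 * \<phi> x" for x
  have lb: "F x \<ge> - (C\<^sup>2)" for x
  proof -
    have "0 \<le> (norm x - C)\<^sup>2" by simp
    moreover have "\<phi> x \<le> norm x * C" using C[of x] by simp
    ultimately show ?thesis unfolding F_def by (simp add: power2_eq_square algebra_simps)
  qed
  then have bdd: "bdd_below (range F)" by (auto simp: bdd_below_def)
  define I where "I = Inf (range F)"
  have I_le: "I \<le> F x" for x unfolding I_def by (rule cInf_lower[OF _ bdd]) simp
  have "\<exists>x. F x < I + inverse (real (Suc n))" for n
    using cInf_lessD[of "range F" "I + inverse (real (Suc n))"] unfolding I_def by auto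
  then obtain X where X: "\<And>n. F (X n) < I + inverse (real (Suc n))" by metis
  have par: "(norm (x - y))\<^sup>2 \<le> 2 * (F x - I) + 2 * (F y - I)" for x y
  proof -
    have "I \<le> F ((1/2) *\<^sub>R (x + y))" by (rule I_le)
    also have "\<dots> = (norm (x + y))\<^sup>2 / 4 - \<phi> x - \<phi> y"
    proof -
      have "norm ((1/2) *\<^sub>R (x + y)) = norm (x + y) / 2" by simp
      then show ?thesis
        unfolding F_def by (simp only: scaleR add power_divide) (simp add: field_simps)
    qed
    finally have "4 * I \<le> (norm (x + y))\<^sup>2 - 4 * \<phi> x - 4 * \<phi> y" by (simp add: algebra_simps)
    moreover have "(norm (x + y))\<^sup>2 + (norm (x - y))\<^sup>2 = 2 * (norm x)\<^sup>2 + 2 * (norm y)\<^sup>2"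
      by (simp add: norm_sq_add norm_sq_diff)
    ultimately show ?thesis unfolding F_def by (simp add: algebra_simps)
  qed
  have "Cauchy X"
  proof (rule metric_CauchyI)
    fix e :: real assume e: "e > 0"
    obtain N where N: "inverse (real (Suc N)) < e\<^sup>2 / 4"
      using reals_Archimedean[of "e\<^sup>2 / 4"] e by auto
    have small: "F (X m) - I < e\<^sup>2 / 4" if "m \<ge> N" for m
    proof -
      have "inverse (real (Suc m)) \<le> inverse (real (Suc N))" using that by (simp add: field_simps)
      then show ?thesis using X[of m] N by linarith
    qed
    have "dist (X m) (X n) < e" if "m \<ge> N" "n \<ge> N" for m n
    proof -
      have "(norm (X m - X n))\<^sup>2 < e\<^sup>2"
        proof -
        have "2 * a + 2 * b < q" if "a < q / 4" "b < q / 4" for a b q :: real using that by simp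
        from this[OF small[OF that(1)] small[OF that(2)]] par[of "X m" "X n"] show ?thesis by (rule le_less_trans[rotated])
      qed
      then show ?thesis using e by (simp add: dist_norm power2_less_imp_less)
    qed
    then show "\<exists>M. \<forall>m\<ge>M. \<forall>n\<ge>M. dist (X m) (X n) < e" by blast
  qed
  then obtain z where z: "X \<longlonglongrightarrow> z" using Cauchy_convergent convergent_def by blast
  have "(\<lambda>n. F (X n)) \<longlonglongrightarrow> F z"
    unfolding F_def by (intro tendsto_intros tendsto z)
  moreover have "(\<lambda>n. I + inverse (real (Suc n))) \<longlonglongrightarrow> I"
    using tendsto_add[OF tendsto_const[of I] LIMSEQ_inverse_real_of_nat] by simp
  ultimately have "F z \<le> I"
    using X by (intro LIMSEQ_le) (auto intro: less_imp_le)
  then have min: "F z \<le> F y" for y using I_le[of y] by linarith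
  have "\<phi> x = Re (cinner x z)" for x
  proof -
    define d where "d = \<phi> x - Re (cinner x z)"
    have key: "0 \<le> t\<^sup>2 * (norm x)\<^sup>2 - 2 * t * d" for t :: real
    proof -
      have "F (z + t *\<^sub>R x) = F z + (t\<^sup>2 * (norm x)\<^sup>2 - 2 * t * d)"
        unfolding F_def d_def
        by (simp add: norm_sq_add scaleR add Re_cinner_commute[of z] power_mult_distrib algebra_simps)
      then show ?thesis using min[of "z + t *\<^sub>R x"] by simp
    qed
    show ?thesis
    proof (cases "x = 0")
      case False
      then have nx: "(norm x)\<^sup>2 > 0" by simp
      \<comment> \<open>The step \<open>t = d / \<parallel>x\<parallel>\<^sup>2\<close> minimises the quadratic polynomial in \<open>key\<close>.\<close>
      have eq: "(d / N)\<^sup>2 * N - 2 * (d / N) * d = - (d\<^sup>2 / N)" if "N > 0" for N :: real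
        using that by (simp add: field_simps power2_eq_square)
      have "0 \<le> - (d\<^sup>2 / (norm x)\<^sup>2)"
        using key[of "d / (norm x)\<^sup>2"] unfolding eq[OF nx] .
      moreover have "d\<^sup>2 / (norm x)\<^sup>2 > 0" if "d \<noteq> 0" using that nx by (intro divide_pos_pos) auto
      ultimately have "d = 0" by linarith
      then show ?thesis by (simp add: d_def)
    qed (simp add: zero)
  qed
  then show ?thesis by blast
qed

text \<open>The real part of the identity is the Riesz representation of \<open>x \<mapsto> Re \<langle>Tx, y\<rangle>\<close>; complex linearity
  of \<open>T\<close>, applied to \<open>\<i>x\<close>, supplies the imaginary part.\<close>

lemma adjoint_exists:
  fixes T :: "'a :: separable_hilbert \<Rightarrow>\<^sub>L 'a"
  assumes "is_clinear T"
  shows "\<exists>S. \<forall>x y. cinner (blinfun_apply T x) y = cinner x (blinfun_apply S y)"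
proof -
  have "\<exists>z. \<forall>x. Re (cinner (T x) y) = Re (cinner x z)" for y
  proof (rule Riesz_representation)
    show "bounded_linear (\<lambda>x. Re (cinner (T x) y))"
      by (intro bounded_linear_compose[OF bounded_linear_Re]
          bounded_linear_compose[OF bounded_linear_cinner_left] blinfun.bounded_linear_right)
  qed
  then obtain S where S: "\<And>x y. Re (cinner (T x) y) = Re (cinner x (S y))" by metis
  have full: "cinner (T x) y = cinner x (S y)" for x y
  proof (rule complex_eqI)
    have "Re (cinner (T (\<i> *\<^sub>C x)) y) = Re (cinner (\<i> *\<^sub>C x) (S y))" by (rule S)
    then show "Im (cinner (T x) y) = Im (cinner x (S y))"
      using assms by (simp add: is_clinear_def cinner_scaleC_left)
  qed (rule S)
  have "bounded_linear S"
  proof (rule bounded_linear_intro[where K = "norm T"])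
    show "S (x + y) = S x + S y" for x y
      by (rule cinner_eq_all_Re) (simp add: cinner_add_right full[symmetric])
    show "S (r *\<^sub>R x) = r *\<^sub>R S x" for r x
      by (rule cinner_eq_all_Re) (simp add: full[symmetric])
    show "norm (S x) \<le> norm x * norm T" for x
    proof (cases "S x = 0")
      case False
      have "(norm (S x))\<^sup>2 = Re (cinner (T (S x)) x)" by (simp add: norm_sq_eq full)
      also have "\<dots> \<le> norm (T (S x)) * norm x" by (rule Re_cinner_le)
      also have "\<dots> \<le> norm T * norm (S x) * norm x"
        by (intro mult_right_mono norm_blinfun) simp
      finally show ?thesis using False by (simp add: power2_eq_square mult_ac)
    qed simp
  qed
  then have "blinfun_apply (Blinfun S) = S" by (rule bounded_linear_Blinfun_apply)
  with full show ?thesis by metis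
qed

lemma adj_unique:
  assumes "\<And>x y. cinner (blinfun_apply T x) y = cinner x (blinfun_apply S y)"
  shows "adj T = S"
  unfolding adj_def
proof (rule the_equality)
  fix S' assume S': "\<forall>x y. cinner (T x) y = cinner x (blinfun_apply S' y)"
  show "S' = S"
    by (rule blinfun_eqI, rule cinner_eq_all_Re) (metis S' assms)
qed (use assms in blast)

lemma cinner_adj:
  fixes T :: "'a :: separable_hilbert \<Rightarrow>\<^sub>L 'a"
  assumes "is_clinear T"
  shows "cinner (blinfun_apply T x) y = cinner x (blinfun_apply (adj T) y)"
  using adjoint_exists[OF assms] adj_unique by metis

lemma cinner_adj':
  fixes T :: "'a :: separable_hilbert \<Rightarrow>\<^sub>L 'a"
  assumes "is_clinear T"
  shows "cinner (blinfun_apply (adj T) x) y = cinner x (blinfun_apply T y)"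
  by (metis cinner_adj[OF assms] cinner_commute)

lemma is_clinear_adj:
  fixes T :: "'a :: separable_hilbert \<Rightarrow>\<^sub>L 'a"
  assumes "is_clinear T"
  shows "is_clinear (adj T)"
  unfolding is_clinear_def
proof (intro allI, rule cinner_eq_all_Re)
  fix a x z
  have "cinner (adj T (a *\<^sub>C x)) z = cinner (a *\<^sub>C adj T x) z"
    by (simp add: cinner_adj'[OF assms] cinner_scaleC_left)
  then show "Re (cinner z (adj T (a *\<^sub>C x))) = Re (cinner z (a *\<^sub>C adj T x))"
    by (metis Re_cinner_commute)
qed

lemma is_clinear_compose: "is_clinear T \<Longrightarrow> is_clinear S \<Longrightarrow> is_clinear (T o\<^sub>L S)"
  by (simp add: is_clinear_def)

lemma norm_adj_le:
  fixes T :: "'a :: separable_hilbert \<Rightarrow>\<^sub>L 'a"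
  assumes "is_clinear T"
  shows "norm (adj T) \<le> norm T"
proof (rule norm_blinfun_bound)
  fix x
  show "norm (adj T x) \<le> norm T * norm x"
  proof (cases "adj T x = 0")
    case False
    have "(norm (adj T x))\<^sup>2 = Re (cinner (T (adj T x)) x)"
      by (simp add: norm_sq_eq cinner_adj[OF assms])
    also have "\<dots> \<le> norm (T (adj T x)) * norm x" by (rule Re_cinner_le)
    also have "\<dots> \<le> norm T * norm (adj T x) * norm x"
      by (intro mult_right_mono norm_blinfun) simp
    finally show ?thesis using False by (simp add: power2_eq_square mult_ac)
  qed simp
qed simp

section \<open>Bessel systems and the Hilbert sum\<close>

text \<open>Bessel's inequality is all that the Ky Fan estimates use of an orthonormal system. In contrast to
  orthonormality it passes to images under contractions.\<close>

definition bessel :: "nat \<Rightarrow> (nat \<Rightarrow> 'a :: complex_inner) \<Rightarrow> bool" where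
  "bessel n e \<longleftrightarrow> (\<forall>x. (\<Sum>k<n. (cmod (cinner x (e k)))\<^sup>2) \<le> (norm x)\<^sup>2)"

lemma besselD: "bessel n e \<Longrightarrow> (\<Sum>k<n. (cmod (cinner x (e k)))\<^sup>2) \<le> (norm x)\<^sup>2"
  by (simp add: bessel_def)

lemma bessel_norm_le:
  assumes "bessel n e" "k < n"
  shows "norm (e k) \<le> 1"
proof (cases "e k = 0")
  case False
  have "(cmod (cinner (e k) (e k)))\<^sup>2 \<le> (\<Sum>k'<n. (cmod (cinner (e k) (e k')))\<^sup>2)"
    using assms(2) by (intro member_le_sum) auto
  also have "\<dots> \<le> (norm (e k))\<^sup>2" by (rule besselD[OF assms(1)])
  finally have "((norm (e k))\<^sup>2)\<^sup>2 \<le> (norm (e k))\<^sup>2"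
    unfolding cinner_self norm_of_real by simp
  then have "(norm (e k))\<^sup>2 \<le> 1" using False by (simp add: power2_eq_square)
  then show ?thesis by (simp add: power_le_one_iff abs_square_le_1)
qed simp

text \<open>Zero vectors are admitted so that the Schmidt vectors of an operator of finite rank can be
  indexed by all natural numbers.\<close>

definition orthonormal_or_zero :: "(nat \<Rightarrow> 'a :: complex_inner) \<Rightarrow> bool" where
  "orthonormal_or_zero e \<longleftrightarrow> (\<forall>i j. i \<noteq> j \<longrightarrow> cinner (e i) (e j) = 0) \<and> (\<forall>i. norm (e i) \<in> {0, 1})"

lemma orthonormal_or_zero_cinner_sum:
  assumes "orthonormal_or_zero e" "finite I" "j \<in> I"
  shows "cinner (\<Sum>i\<in>I. c i *\<^sub>C e i) (e j) = c j * (norm (e j))\<^sup>2"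
proof -
  have "cinner (\<Sum>i\<in>I. c i *\<^sub>C e i) (e j) = (\<Sum>i\<in>I. if i = j then c j * (norm (e j))\<^sup>2 else 0)"
    unfolding cinner_sum_left
    by (rule sum.cong) (use assms in \<open>auto simp: cinner_scaleC_left orthonormal_or_zero_def cinner_self\<close>)
  then show ?thesis using assms by simp
qed

lemma orthonormal_or_zero_residual:
  assumes "orthonormal_or_zero e" "finite I" "j \<in> I"
  shows "cinner (x - (\<Sum>i\<in>I. cinner x (e i) *\<^sub>C e i)) (e j) = 0"
proof -
  have "norm (e j) = 0 \<or> norm (e j) = 1" using assms(1) by (auto simp: orthonormal_or_zero_def)
  then have "cinner x (e j) * (norm (e j))\<^sup>2 = cinner x (e j)" by auto
  then show ?thesis
    unfolding cinner_diff_left by (subst orthonormal_or_zero_cinner_sum[OF assms]) simp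
qed

lemma norm_residual_sq:
  assumes "orthonormal_or_zero e" "finite I"
  shows "(norm (x - (\<Sum>i\<in>I. cinner x (e i) *\<^sub>C e i)))\<^sup>2
           = (norm x)\<^sup>2 - (\<Sum>i\<in>I. (cmod (cinner x (e i)))\<^sup>2)"
proof -
  define r where "r = x - (\<Sum>i\<in>I. cinner x (e i) *\<^sub>C e i)"
  have "cinner r (\<Sum>i\<in>I. cinner x (e i) *\<^sub>C e i) = 0"
    unfolding cinner_sum_right cinner_scaleC_right
    using orthonormal_or_zero_residual[OF assms] by (simp add: r_def)
  then have "(norm r)\<^sup>2 = Re (cinner r x)"
    unfolding norm_sq_eq by (metis cinner_diff_right diff_zero r_def)
  also have "\<dots> = Re (cinner x x) - (\<Sum>i\<in>I. Re (cinner x (e i) * cinner (e i) x))"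
    unfolding r_def cinner_diff_left cinner_sum_left cinner_scaleC_left by simp
  also have "\<dots> = (norm x)\<^sup>2 - (\<Sum>i\<in>I. (cmod (cinner x (e i)))\<^sup>2)"
  proof -
    have "Re (cinner x (e i) * cinner (e i) x) = (cmod (cinner x (e i)))\<^sup>2" for i
      by (subst (2) cinner_commute) (simp add: complex_norm_square[symmetric] del: of_real_power)
    then show ?thesis by (simp add: norm_sq_eq)
  qed
  finally show ?thesis by (simp add: r_def)
qed

lemma orthonormal_or_zero_bessel:
  assumes "orthonormal_or_zero e"
  shows "bessel n e"
  unfolding bessel_def
proof
  fix x
  show "(\<Sum>k<n. (cmod (cinner x (e k)))\<^sup>2) \<le> (norm x)\<^sup>2"
    using norm_residual_sq[OF assms finite_lessThan, of x n]
      zero_le_power2[of "norm (x - (\<Sum>k<n. cinner x (e k) *\<^sub>C e k))"] by linarith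
qed

instantiation prod :: (complex_inner, complex_inner) complex_inner
begin

definition scaleC_prod :: "complex \<Rightarrow> 'a \<times> 'b \<Rightarrow> 'a \<times> 'b" where
  "scaleC_prod c x = (c *\<^sub>C fst x, c *\<^sub>C snd x)"

definition cinner_prod :: "'a \<times> 'b \<Rightarrow> 'a \<times> 'b \<Rightarrow> complex" where
  "cinner_prod x y = cinner (fst x) (fst y) + cinner (snd x) (snd y)"

instance
proof
  fix x y z :: "'a \<times> 'b" and a b :: complex and r :: real
  show "cinner x y = cnj (cinner y x)"
    unfolding cinner_prod_def by (metis cinner_commute complex_cnj_add)
  show "cinner x x = complex_of_real ((norm x)\<^sup>2)"
    unfolding cinner_prod_def cinner_self norm_prod_def by simp
  show "a *\<^sub>C (x + y) = a *\<^sub>C x + a *\<^sub>C y" "(a + b) *\<^sub>C x = a *\<^sub>C x + b *\<^sub>C x"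
    by (simp_all add: scaleC_prod_def scaleC_add_right scaleC_add_left)
  show "a *\<^sub>C b *\<^sub>C x = (a * b) *\<^sub>C x" "1 *\<^sub>C x = x"
    by (simp_all add: scaleC_prod_def scaleC_scaleC scaleC_one)
  show "r *\<^sub>R x = complex_of_real r *\<^sub>C x"
    by (simp add: scaleC_prod_def scaleR_prod_def scaleR_scaleC)
  show "cinner (x + y) z = cinner x z + cinner y z"
    by (simp add: cinner_prod_def cinner_add_left)
  show "cinner (a *\<^sub>C x) y = a * cinner x y"
    by (simp add: cinner_prod_def scaleC_prod_def cinner_scaleC_left distrib_left)
qed

end

lemma cinner_Pair [simp]: "cinner (a, b) (c, d) = cinner a c + cinner b d"
  by (simp add: cinner_prod_def)

section \<open>Symmetric gauge functions and Ky Fan dominance\<close>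

definition cut :: "nat \<Rightarrow> (nat \<Rightarrow> real) \<Rightarrow> nat \<Rightarrow> real" where
  "cut n s = (\<lambda>i. if i < n then s i else 0)"

lemma finitely_supported_cut [simp]: "finitely_supported (cut n s)"
  unfolding finitely_supported_def cut_def
  by (rule finite_subset[of _ "{..<n}"]) auto

lemma gauge_ext_cut: "gauge_ext g s = (SUP n. ereal (g (cut n s)))"
  by (simp add: gauge_ext_def cut_def)

context
  fixes g :: "(nat \<Rightarrow> real) \<Rightarrow> real"
  assumes g: "symmetric_gauge g"
begin

lemma gauge_nonneg: "finitely_supported s \<Longrightarrow> 0 \<le> g s"
  and gauge_scale: "finitely_supported s \<Longrightarrow> g (\<lambda>i. c * s i) = \<bar>c\<bar> * g s"
  and gauge_triangle: "finitely_supported s \<Longrightarrow> finitely_supported t \<Longrightarrow> g (\<lambda>i. s i + t i) \<le> g s + g t"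
  and gauge_perm: "finitely_supported s \<Longrightarrow> bij \<pi> \<Longrightarrow> g (\<lambda>i. s (\<pi> i)) = g s"
  and gauge_sign: "finitely_supported s \<Longrightarrow> (\<And>i. \<epsilon> i \<in> {-1, 1}) \<Longrightarrow> g (\<lambda>i. \<epsilon> i * s i) = g s"
  using g unfolding symmetric_gauge_def by blast+

lemma gauge_zero: "g (\<lambda>i. 0) = 0"
  using g unfolding symmetric_gauge_def finitely_supported_def by auto

lemma gauge_convex:
  assumes "finitely_supported s" "finitely_supported t" "0 \<le> l" "l \<le> 1" "g t \<le> g s"
  shows "g (\<lambda>i. (1 - l) * s i + l * t i) \<le> g s"
proof -
  have "finitely_supported (\<lambda>i. c * s' i)" if "finitely_supported s'" for c and s' :: "nat \<Rightarrow> real"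
    using that unfolding finitely_supported_def by (rule rev_finite_subset) auto
  then have "g (\<lambda>i. (1 - l) * s i + l * t i) \<le> g (\<lambda>i. (1 - l) * s i) + g (\<lambda>i. l * t i)"
    using assms by (intro gauge_triangle) auto
  also have "\<dots> = (1 - l) * g s + l * g t" using assms by (simp add: gauge_scale)
  also have "\<dots> \<le> (1 - l) * g s + l * g s" using assms by (intro add_left_mono mult_left_mono) auto
  finally show ?thesis by (simp add: algebra_simps)
qed

text \<open>Lowering a coordinate replaces the sequence by a mean of itself and the sequence with the sign
  of that coordinate flipped.\<close>

lemma gauge_mono_coord:
  assumes "finitely_supported y" "0 \<le> c" "c \<le> y k"
  shows "g (y(k := c)) \<le> g y"
proof (cases "y k = 0")
  case True
  then show ?thesis using assms by (metis antisym fun_upd_triv order_refl)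
next
  case False
  define l where "l = (y k - c) / (2 * y k)"
  define t where "t = (\<lambda>i. (if i = k then -1 else 1) * y i)"
  have yk: "y k > 0" using False assms by simp
  have "finitely_supported t"
    using assms(1) unfolding finitely_supported_def t_def by (rule rev_finite_subset) auto
  moreover have "g t = g y" unfolding t_def using assms(1) by (intro gauge_sign) auto
  ultimately have "g (\<lambda>i. (1 - l) * y i + l * t i) \<le> g y"
    using assms yk by (intro gauge_convex) (auto simp: l_def field_simps)
  moreover have "(\<lambda>i. (1 - l) * y i + l * t i) = y(k := c)"
    using yk by (auto simp: fun_eq_iff l_def t_def field_simps)
  ultimately show ?thesis by simp
qed

lemma gauge_mono:
  assumes "\<And>i. i < n \<Longrightarrow> 0 \<le> x i \<and> x i \<le> y i"
  shows "g (cut n x) \<le> g (cut n y)"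
proof -
  have "m \<le> n \<Longrightarrow> g (\<lambda>i. if i < m then x i else cut n y i) \<le> g (cut n y)" for m
  proof (induction m)
    case (Suc m)
    let ?z = "\<lambda>i. if i < m then x i else cut n y i"
    have "?z = cut n (\<lambda>i. if i < m then x i else y i)" using Suc.prems by (auto simp: cut_def)
    then have "finitely_supported ?z" by simp
    then have "g (?z(m := x m)) \<le> g ?z"
      using assms[of m] Suc.prems by (intro gauge_mono_coord) (auto simp: cut_def)
    also have "?z(m := x m) = (\<lambda>i. if i < Suc m then x i else cut n y i)" by auto
    finally show ?case using Suc by simp
  qed simp
  from this[of n] show ?thesis
    by (simp add: cut_def if_distrib cong: if_cong)
qed

text \<open>Moving an amount \<open>d\<close> from a larger coordinate to a smaller one averages the sequence with
  its transposed copy.\<close>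

lemma gauge_transfer:
  assumes "finitely_supported y" "j \<noteq> k" "0 \<le> d" "d \<le> y j - y k"
  shows "g (y(j := y j - d, k := y k + d)) \<le> g y"
proof (cases "y j = y k")
  case True
  then have "d = 0" using assms by simp
  then show ?thesis by simp
next
  case False
  define t where "t = (\<lambda>i. y (Transposition.transpose j k i))"
  define l where "l = d / (y j - y k)"
  have p: "y j - y k > 0" using False assms by linarith
  have t_eq: "t = y(j := y k, k := y j)"
    using assms(2) by (auto simp: t_def fun_eq_iff Transposition.transpose_def)
  have "finitely_supported t"
    using assms(1) unfolding finitely_supported_def t_eq
    by (rule rev_finite_subset[OF finite.insertI[OF finite.insertI]]) (auto split: if_splits)
  moreover have "g t = g y" unfolding t_def using assms(1) by (intro gauge_perm) auto
  ultimately have "g (\<lambda>i. (1 - l) * y i + l * t i) \<le> g y"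
    using assms p by (intro gauge_convex) (auto simp: l_def field_simps)
  moreover have "(\<lambda>i. (1 - l) * y i + l * t i) = y(j := y j - d, k := y k + d)"
  proof
    fix i
    have "l * (y j - y k) = d" using p by (simp add: l_def)
    then show "(1 - l) * y i + l * t i = (y(j := y j - d, k := y k + d)) i"
      using assms(2) by (auto simp: t_eq algebra_simps)
  qed
  ultimately show ?thesis by simp
qed

text \<open>This is the Hardy-Littlewood-Polya induction on the number of indices where the sequences differ.
  If \<open>x \<le> y\<close> fails, let \<open>k\<close> be the first index with \<open>x\<^sub>k > y\<^sub>k\<close> and \<open>j < k\<close> the last one before it with
  \<open>x\<^sub>j < y\<^sub>j\<close>. Moving \<open>min (y\<^sub>j - x\<^sub>j) (x\<^sub>k - y\<^sub>k)\<close> from \<open>y\<^sub>j\<close> to \<open>y\<^sub>k\<close> creates an agreement and does not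
  increase the gauge; the dominance of partial sums survives since \<open>x\<close> and \<open>y\<close> agree strictly between
  \<open>j\<close> and \<open>k\<close>. Monotonicity of \<open>x\<close> ensures \<open>y\<^sub>k < y\<^sub>j\<close>. The induction runs over arbitrary
  nonnegative \<open>y\<close>, since the transfer may destroy a monotone order.\<close>

lemma Fan_dominance_cut:
  assumes "decseq x" "\<And>i. 0 \<le> x i" "\<And>i. 0 \<le> y i"
    and "\<And>r. r \<le> n \<Longrightarrow> (\<Sum>i<r. x i) \<le> (\<Sum>i<r. y i)"
  shows "g (cut n x) \<le> g (cut n y)"
  using assms(3,4)
proof (induction "card {i. i < n \<and> x i \<noteq> y i}" arbitrary: y rule: less_induct)
  case (less y)
  show ?case
  proof (cases "\<exists>k<n. y k < x k")
    case False
    then show ?thesis using assms(2) by (intro gauge_mono) (meson not_less)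
  next
    case True
    define k where "k = (LEAST k. k < n \<and> y k < x k)"
    have k: "k < n" "y k < x k" using LeastI_ex[OF True] by (auto simp: k_def)
    have k_min: "x i \<le> y i" if "i < k" for i
      using not_less_Least[of i "\<lambda>k. k < n \<and> y k < x k"] that k(1) by (auto simp: k_def)
    have "\<exists>j<k. x j < y j"
    proof (rule ccontr)
      assume "\<not> ?thesis"
      then have "(\<Sum>i<k. x i) = (\<Sum>i<k. y i)"
        using k_min by (intro sum.cong refl antisym) (meson lessThan_iff not_less)+
      moreover have "(\<Sum>i<Suc k. x i) \<le> (\<Sum>i<Suc k. y i)" using k by (intro less.prems) simp
      ultimately show False using k by simp
    qed
    then obtain j0 where j0: "j0 < k \<and> x j0 < y j0" by blast
    define j where "j = (GREATEST j. j < k \<and> x j < y j)"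
    have j: "j < k" "x j < y j"
      using GreatestI_nat[of "\<lambda>j. j < k \<and> x j < y j" j0 k] j0 by (auto simp: j_def)
    have j_max: "x i = y i" if "j < i" "i < k" for i
    proof -
      have "\<not> x i < y i"
        using Greatest_le_nat[of "\<lambda>j. j < k \<and> x j < y j" i k] that by (auto simp: j_def)
      then show ?thesis using k_min[OF that(2)] by simp
    qed
    define d where "d = min (y j - x j) (x k - y k)"
    define y' where "y' = y(j := y j - d, k := y k + d)"
    have d: "0 < d" "d \<le> y j - x j" "d \<le> x k - y k" using j k by (auto simp: d_def)
    have "x k \<le> x j" using assms(1) j by (simp add: decseq_def)
    then have dd: "d \<le> y j - y k" using d j by linarith
    have "cut n y' = (cut n y)(j := cut n y j - d, k := cut n y k + d)"
      using j k by (auto simp: cut_def y'_def fun_eq_iff)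
    moreover have vals: "cut n y j = y j" "cut n y k = y k" using j k by (simp_all add: cut_def)
    ultimately have "g (cut n y') \<le> g (cut n y)"
      using gauge_transfer[of "cut n y" j k d] j d dd vals by simp
    moreover have "g (cut n x) \<le> g (cut n y')"
    proof (rule less.hyps)
      have "{i. i < n \<and> x i \<noteq> y' i} \<subset> {i. i < n \<and> x i \<noteq> y i}"
      proof
        show "{i. i < n \<and> x i \<noteq> y' i} \<subseteq> {i. i < n \<and> x i \<noteq> y i}"
          using j k by (auto simp: y'_def split: if_splits)
        have "x j = y' j \<or> x k = y' k" using j by (auto simp: y'_def d_def min_def)
        then show "{i. i < n \<and> x i \<noteq> y' i} \<noteq> {i. i < n \<and> x i \<noteq> y i}"
        proof
          assume "x j = y' j"
          then have "j \<in> {i. i < n \<and> x i \<noteq> y i} - {i. i < n \<and> x i \<noteq> y' i}" using j k by simp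
          then show ?thesis by blast
        next
          assume "x k = y' k"
          then have "k \<in> {i. i < n \<and> x i \<noteq> y i} - {i. i < n \<and> x i \<noteq> y' i}" using k by simp
          then show ?thesis by blast
        qed
      qed
      then show "card {i. i < n \<and> x i \<noteq> y' i} < card {i. i < n \<and> x i \<noteq> y i}"
        by (intro psubset_card_mono) auto
      show "0 \<le> y' i" for i
      proof -
        have "0 \<le> x j" by (rule assms)
        then have "0 \<le> y j - d" using d by linarith
        moreover have "0 \<le> y k + d" using less.prems(1)[of k] d by linarith
        ultimately show ?thesis using less.prems(1)[of i] by (auto simp: y'_def)
      qed
      show "(\<Sum>i<r. x i) \<le> (\<Sum>i<r. y' i)" if "r \<le> n" for r
      proof -
        have sum_y': "(\<Sum>i<r. y' i) = (\<Sum>i<r. y i) - (if j < r then d else 0) + (if k < r then d else 0)"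
        proof -
          have "y' i = y i - (if i = j then d else 0) + (if i = k then d else 0)" for i
            using j by (auto simp: y'_def)
          then show ?thesis by (simp add: sum.distrib sum_subtractf)
        qed
        show ?thesis
        proof (cases "j < r \<and> r \<le> k")
          case False
          then have "(\<Sum>i<r. y' i) = (\<Sum>i<r. y i)" using sum_y' j by auto
          then show ?thesis using less.prems(2)[OF that] by simp
        next
          case True
          have split: "(\<Sum>i<r. f i) = (\<Sum>i<j. f i) + f j + (\<Sum>i=Suc j..<r. f i)" for f :: "nat \<Rightarrow> real"
          proof -
            have "{..<r} = {..<j} \<union> {j} \<union> {Suc j..<r}" using True by auto
            then have "(\<Sum>i<r. f i) = (\<Sum>i\<in>{..<j} \<union> {j} \<union> {Suc j..<r}. f i)" by simp
            also have "\<dots> = (\<Sum>i<j. f i) + f j + (\<Sum>i=Suc j..<r. f i)"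
              by (subst sum.union_disjoint, auto)+
            finally show ?thesis .
          qed
          have "(\<Sum>i=Suc j..<r. x i) = (\<Sum>i=Suc j..<r. y i)"
            using True by (intro sum.cong) (auto intro: j_max)
          moreover have "(\<Sum>i<j. x i) \<le> (\<Sum>i<j. y i)" using j k by (intro less.prems) simp
          ultimately have "(\<Sum>i<r. x i) \<le> (\<Sum>i<r. y i) - d"
            using d unfolding split[of x] split[of y] by linarith
          then show ?thesis using sum_y' True by simp
        qed
      qed
    qed
    ultimately show ?thesis by simp
  qed
qed

lemma Fan_dominance:
  assumes "decseq x" "\<And>i. 0 \<le> x i" "\<And>i. 0 \<le> y i"
    and "\<And>r. (\<Sum>i<r. x i) \<le> (\<Sum>i<r. y i)"
  shows "gauge_ext g x \<le> gauge_ext g y"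
  unfolding gauge_ext_cut using assms by (intro SUP_mono bexI) (auto intro: Fan_dominance_cut)

lemma gauge_ext_nonneg: "0 \<le> gauge_ext g x"
  unfolding gauge_ext_cut by (rule SUP_upper2[of 0]) (auto simp: gauge_nonneg zero_ereal_def)

lemma gauge_ext_zero: "gauge_ext g (\<lambda>i. 0) = 0"
  by (simp add: gauge_ext_def gauge_zero zero_ereal_def)

lemma gauge_ext_add_le: "gauge_ext g (\<lambda>i. x i + y i) \<le> gauge_ext g x + gauge_ext g y"
proof -
  have "ereal (g (cut n (\<lambda>i. x i + y i))) \<le> gauge_ext g x + gauge_ext g y" for n
  proof -
    have "cut n (\<lambda>i. x i + y i) = (\<lambda>i. cut n x i + cut n y i)" by (auto simp: cut_def)
    then have "g (cut n (\<lambda>i. x i + y i)) \<le> g (cut n x) + g (cut n y)"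
      using gauge_triangle[of "cut n x" "cut n y"] by simp
    then have "ereal (g (cut n (\<lambda>i. x i + y i))) \<le> ereal (g (cut n x)) + ereal (g (cut n y))" by simp
    also have "\<dots> \<le> gauge_ext g x + gauge_ext g y"
      unfolding gauge_ext_cut by (intro add_mono SUP_upper) auto
    finally show ?thesis .
  qed
  then show ?thesis by (subst gauge_ext_cut) (rule SUP_least)
qed

lemma gauge_ext_scale:
  assumes "c \<ge> 0"
  shows "gauge_ext g (\<lambda>i. c * x i) = ereal c * gauge_ext g x"
proof -
  have "cut n (\<lambda>i. c * x i) = (\<lambda>i. c * cut n x i)" for n by (auto simp: cut_def)
  then have "g (cut n (\<lambda>i. c * x i)) = c * g (cut n x)" for n using assms by (simp add: gauge_scale)
  then have "gauge_ext g (\<lambda>i. c * x i) = (SUP n. ereal c * ereal (g (cut n x)))"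
    by (simp add: gauge_ext_cut)
  also have "\<dots> = ereal c * (SUP n. ereal (g (cut n x)))"
    using assms by (intro SUP_ereal_mult_left) (auto simp: gauge_nonneg)
  finally show ?thesis by (simp add: gauge_ext_cut)
qed

end

section \<open>Polynomials and powers of a positive operator\<close>

lemma poly_op_eq_sum:
  assumes "degree p \<le> n"
  shows "poly_op p A = (\<Sum>i\<le>n. coeff p i *\<^sub>R ((\<lambda>B. A o\<^sub>L B) ^^ i) id_blinfun)"
  unfolding poly_op_def
  by (rule sum.mono_neutral_left) (use assms in \<open>auto simp: coeff_eq_0\<close>)

lemma poly_op_0 [simp]: "poly_op 0 A = 0"
  by (simp add: poly_op_def)

lemma poly_op_add: "poly_op (p + q) A = poly_op p A + poly_op q A"
proof -
  define n where "n = max (degree p) (degree q)"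
  have "degree (p + q) \<le> n" "degree p \<le> n" "degree q \<le> n"
    by (auto simp: n_def intro: degree_add_le_max)
  then show ?thesis by (simp add: poly_op_eq_sum scaleR_left_distrib sum.distrib)
qed

lemma poly_op_smult: "poly_op (smult c p) A = c *\<^sub>R poly_op p A"
  by (simp add: poly_op_eq_sum[OF degree_smult_le] poly_op_def scaleR_sum_right)

lemma poly_op_diff: "poly_op (p - q) A = poly_op p A - poly_op q A"
  using poly_op_add[of p "smult (-1) q" A] poly_op_smult[of "-1" q A] by simp

lemma poly_op_pCons_apply:
  "blinfun_apply (poly_op (pCons a p) A) x = a *\<^sub>R x + blinfun_apply A (blinfun_apply (poly_op p A) x)"
proof -
  have "poly_op (pCons a p) A
      = (\<Sum>i\<le>Suc (degree p). coeff (pCons a p) i *\<^sub>R ((\<lambda>B. A o\<^sub>L B) ^^ i) id_blinfun)"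
    by (rule poly_op_eq_sum) (simp add: degree_pCons_le)
  also have "\<dots> = a *\<^sub>R id_blinfun + (\<Sum>i\<le>degree p. coeff p i *\<^sub>R (A o\<^sub>L ((\<lambda>B. A o\<^sub>L B) ^^ i) id_blinfun))"
    by (subst sum.atMost_Suc_shift) simp
  finally show ?thesis
    by (simp add: blinfun.add_left blinfun.scaleR_left poly_op_def blinfun.sum_left blinfun.sum_right
        blinfun.scaleR_right)
qed

lemma poly_op_mult_apply:
  "blinfun_apply (poly_op (p * q) A) x = blinfun_apply (poly_op p A) (blinfun_apply (poly_op q A) x)"
proof (induction p)
  case (pCons a p)
  show ?case
    using pCons.IH
    by (simp add: poly_op_add poly_op_smult poly_op_pCons_apply blinfun.add_left blinfun.scaleR_left)
qed simp

lemma poly_op_const_apply [simp]: "blinfun_apply (poly_op [:c:] A) x = c *\<^sub>R x"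
  by (simp add: poly_op_pCons_apply)

definition selfadjoint :: "('a :: complex_inner \<Rightarrow>\<^sub>L 'a) \<Rightarrow> bool" where
  "selfadjoint A \<longleftrightarrow> (\<forall>x y. cinner (blinfun_apply A x) y = cinner x (blinfun_apply A y))"

lemma selfadjointD: "selfadjoint A \<Longrightarrow> cinner (blinfun_apply A x) y = cinner x (blinfun_apply A y)"
  by (simp add: selfadjoint_def)

text \<open>The form \<open>\<langle>Ax, y\<rangle>\<close> is recovered from the real numbers \<open>\<langle>Az, z\<rangle>\<close> with \<open>z = x + y\<close> and
  \<open>z = x + \<i>y\<close>.\<close>

lemma positive_op_selfadjoint:
  assumes "positive_op A"
  shows "selfadjoint A"
  unfolding selfadjoint_def
proof (intro allI)
  fix x y
  have lin: "A (c *\<^sub>C x) = c *\<^sub>C A x" for c x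
    using assms by (simp add: positive_op_def is_clinear_def)
  have real: "Im (cinner (A z) z) = 0" for z
    using assms by (simp add: positive_op_def complex_is_Real_iff)
  have a: "Im (cinner (A x) y) + Im (cinner (A y) x) = 0"
    using real[of "x + y"] real[of x] real[of y] by (simp add: blinfun.add_right cinner_simps)
  have b: "- Re (cinner (A x) y) + Re (cinner (A y) x) = 0"
    using real[of "x + \<i> *\<^sub>C y"] real[of x] real[of y]
    by (simp add: blinfun.add_right lin cinner_simps)
  have "cinner (A x) y = cnj (cinner (A y) x)"
    using a b by (simp add: complex_eq_iff)
  then show "cinner (A x) y = cinner x (A y)" by (metis cinner_commute)
qed

lemma selfadjoint_poly_op:
  assumes "selfadjoint A"
  shows "selfadjoint (poly_op p A)"
proof (induction p)
  case (pCons a p)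
  have "cinner (poly_op (pCons a p) A x) y = cinner x (a *\<^sub>R y + poly_op p A (A y))" for x y
    by (simp add: poly_op_pCons_apply cinner_simps selfadjointD[OF assms] selfadjointD[OF pCons.IH])
  moreover have "poly_op p A (A y) = A (poly_op p A y)" for y
    using poly_op_mult_apply[of p "[:0, 1:]" A y] poly_op_mult_apply[of "[:0, 1:]" p A y]
    by (simp add: poly_op_pCons_apply mult.commute)
  ultimately show ?case by (simp add: selfadjoint_def poly_op_pCons_apply)
qed (simp add: selfadjoint_def)

context
  fixes A :: "'a :: separable_hilbert \<Rightarrow>\<^sub>L 'a" and M :: real
  assumes A: "positive_op A" and M: "0 < M" "norm A \<le> M"
begin

lemma selfadjoint_A: "selfadjoint A"
  by (rule positive_op_selfadjoint[OF A])

text \<open>The goal is the implication from \<open>q \<ge> 0\<close> on \<open>[0, M]\<close> to \<open>q(A) \<ge> 0\<close>. It is proved by induction on the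
  degree: subtract the minimum of \<open>q\<close> and split off the factor that belongs to the point \<open>t\<^sub>0\<close> where it is
  attained. This factor is \<open>(t - t\<^sub>0)\<^sup>2\<close> for an interior point, and \<open>t\<close> or \<open>M - t\<close> at an end point. Squares
  preserve positivity of the form, and positivity of the products of \<open>q\<close> with \<open>t\<close>, \<open>M - t\<close> and
  \<open>t(M - t)\<close> is carried along to cope with the linear factors: a second factor \<open>t\<close> makes a square.\<close>

definition form_nonneg :: "real poly \<Rightarrow> bool" where
  "form_nonneg p \<longleftrightarrow> (\<forall>x. 0 \<le> Re (cinner (blinfun_apply (poly_op p A) x) x))"

lemma form_nonneg_add: "form_nonneg p \<Longrightarrow> form_nonneg q \<Longrightarrow> form_nonneg (p + q)"
  by (simp add: form_nonneg_def poly_op_add blinfun.add_left cinner_simps)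

lemma form_nonneg_smult: "form_nonneg p \<Longrightarrow> 0 \<le> c \<Longrightarrow> form_nonneg (smult c p)"
  by (simp add: form_nonneg_def poly_op_smult blinfun.scaleR_left)

lemma form_nonneg_square_mult:
  assumes "form_nonneg p"
  shows "form_nonneg (q * q * p)"
proof -
  have "cinner (poly_op (q * q * p) A x) x = cinner (poly_op p A (poly_op q A x)) (poly_op q A x)" for x
  proof -
    have "q * q * p = q * (p * q)" by (simp add: mult_ac)
    then show ?thesis
      by (simp only: poly_op_mult_apply selfadjointD[OF selfadjoint_poly_op[OF selfadjoint_A]])
  qed
  then show ?thesis using assms by (simp add: form_nonneg_def)
qed

text \<open>The product weight is positive since \<open>M t(M - t) = (M - t)\<^sup>2t + t\<^sup>2(M - t)\<close>.\<close>

lemma form_nonneg_weights: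
  "form_nonneg [:1:]" "form_nonneg [:0, 1:]" "form_nonneg [:M, -1:]" "form_nonneg ([:0, 1:] * [:M, -1:])"
proof -
  show 1: "form_nonneg [:1:]"
    by (simp add: form_nonneg_def norm_sq_eq[symmetric])
  show t: "form_nonneg [:0, 1:]"
    using A by (simp add: form_nonneg_def poly_op_pCons_apply positive_op_def)
  show Mt: "form_nonneg [:M, -1:]"
  proof -
    have "0 \<le> M * (norm x)\<^sup>2 - Re (cinner (A x) x)" for x
    proof -
      have "Re (cinner (A x) x) \<le> norm (A x) * norm x" by (rule Re_cinner_le)
      also have "\<dots> \<le> norm A * norm x * norm x" by (intro mult_right_mono norm_blinfun) simp
      also have "\<dots> \<le> M * norm x * norm x" using M by (intro mult_right_mono) auto
      finally show ?thesis by (simp add: power2_eq_square mult.assoc)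
    qed
    then show ?thesis
      by (simp add: form_nonneg_def poly_op_pCons_apply cinner_simps norm_sq_eq blinfun.minus_right)
  qed
  have "smult (1/M) ([:M, -1:] * [:M, -1:] * [:0, 1:] + [:0, 1:] * [:0, 1:] * [:M, -1:])
          = [:0, 1:] * [:M, -1:]"
    using M by simp
  then show "form_nonneg ([:0, 1:] * [:M, -1:])"
    by (metis form_nonneg_smult form_nonneg_add form_nonneg_square_mult t Mt M(1)
        less_imp_le zero_le_divide_1_iff)
qed

definition weighted_nonneg :: "real poly \<Rightarrow> bool" where
  "weighted_nonneg q \<longleftrightarrow> form_nonneg q \<and> form_nonneg ([:0, 1:] * q) \<and> form_nonneg ([:M, -1:] * q) \<and>
     form_nonneg ([:0, 1:] * [:M, -1:] * q)"

lemma weighted_nonneg_const: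
  assumes "0 \<le> c"
  shows "weighted_nonneg [:c:]"
proof -
  have "q * [:c:] = smult c q" for q :: "real poly" by (simp add: mult.commute)
  moreover have "[:c:] = smult c [:1:]" by simp
  ultimately show ?thesis
    unfolding weighted_nonneg_def using form_nonneg_weights assms form_nonneg_smult by metis
qed

lemma weighted_nonneg_add: "weighted_nonneg p \<Longrightarrow> weighted_nonneg q \<Longrightarrow> weighted_nonneg (p + q)"
  unfolding weighted_nonneg_def distrib_left by (intro conjI form_nonneg_add) (elim conjE, assumption)+

lemma weighted_nonneg_mult:
  assumes "weighted_nonneg q"
  shows "weighted_nonneg ([:0, 1:] * q)" "weighted_nonneg ([:M, -1:] * q)" "weighted_nonneg (u * u * q)"
proof -
  have q: "form_nonneg q" "form_nonneg ([:0, 1:] * q)" "form_nonneg ([:M, -1:] * q)"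
    "form_nonneg ([:0, 1:] * [:M, -1:] * q)"
    using assms by (auto simp: weighted_nonneg_def)
  note sq = form_nonneg_square_mult
  have "form_nonneg (t * (t * q'))" if "form_nonneg q'" for t q'
    using sq[OF that, of t] by (simp only: mult.assoc)
  note sq' = this
  show "weighted_nonneg ([:0, 1:] * q)"
    unfolding weighted_nonneg_def
    using q sq'[OF q(1), of "[:0, 1:]"] sq'[OF q(3), of "[:0, 1:]"] by (simp only: mult_ac)
  show "weighted_nonneg ([:M, -1:] * q)"
    unfolding weighted_nonneg_def
    using q sq'[OF q(1), of "[:M, -1:]"] sq'[OF q(2), of "[:M, -1:]"] by (simp only: mult_ac)
  show "weighted_nonneg (u * u * q)"
    unfolding weighted_nonneg_def
    using sq[OF q(1), of u] sq[OF q(2), of u] sq[OF q(3), of u] sq[OF q(4), of u]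
    by (simp only: mult_ac)
qed

lemma nonneg_of_pos_mult: "0 \<le> a * b \<Longrightarrow> 0 < a \<Longrightarrow> 0 \<le> (b :: real)"
  by (simp add: zero_le_mult_iff)

text \<open>After division by a factor that vanishes at \<open>t\<^sub>0\<close>, the sign of the quotient is known everywhere else;
  continuity fills the gap because no point of a nondegenerate interval is isolated.\<close>

lemma poly_nonneg_at_excluded_point:
  fixes r :: "real poly"
  assumes "t0 \<in> {0..M}" "\<And>t. t \<in> {0..M} \<Longrightarrow> t \<noteq> t0 \<Longrightarrow> 0 \<le> poly r t"
  shows "0 \<le> poly r t0"
proof -
  have "(poly r \<longlongrightarrow> poly r t0) (at t0 within {0..M})"
    by (intro tendsto_intros)
  moreover have "eventually (\<lambda>t. 0 \<le> poly r t) (at t0 within {0..M})"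
    unfolding eventually_at_topological using assms(2) by blast
  moreover have "at t0 within {0..M} \<noteq> bot"
    using assms(1) M(1) by (subst trivial_limit_within) (simp add: islimpt_Icc)
  ultimately show ?thesis by (rule tendsto_lowerbound)
qed

lemma nonneg_imp_weighted_nonneg:
  assumes "\<And>t. t \<in> {0..M} \<Longrightarrow> 0 \<le> poly q t"
  shows "weighted_nonneg q"
  using assms
proof (induction "degree q" arbitrary: q rule: less_induct)
  case (less q)
  show ?case
  proof (cases "degree q = 0")
    case True
    then obtain c where c: "q = [:c:]" by (metis degree_eq_zeroE)
    then have "0 \<le> c" using less.prems[of 0] M(1) by simp
    then show ?thesis unfolding c by (rule weighted_nonneg_const)
  next
    case False
    have "\<exists>t0\<in>{0..M}. \<forall>t\<in>{0..M}. poly q t0 \<le> poly q t"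
      using M(1) by (intro continuous_attains_inf) (auto intro: continuous_intros)
    then obtain t0 where t0: "t0 \<in> {0..M}" "\<And>t. t \<in> {0..M} \<Longrightarrow> poly q t0 \<le> poly q t"
      by blast
    define m where "m = poly q t0"
    have m: "0 \<le> m" using less.prems t0(1) by (simp add: m_def)
    have "poly (q - [:m:]) t0 = 0" by (simp add: m_def)
    then obtain r where r: "q - [:m:] = [:-t0, 1:] * r" by (metis poly_eq_0_iff_dvd dvdE)
    have deg_qm: "degree (q - [:m:]) = degree q"
      using False by (metis degree_add_eq_left degree_pCons_0 diff_conv_add_uminus minus_pCons
          neg_equal_0_iff_equal neq0_conv minus_zero)
    have r0: "r \<noteq> 0" using deg_qm False r by auto
    then have deg_r: "degree q = Suc (degree r)"
      using deg_qm unfolding r by (subst (asm) degree_mult_eq) auto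
    have r_val: "0 \<le> (t - t0) * poly r t" if "t \<in> {0..M}" for t
    proof -
      have "poly (q - [:m:]) t = (t - t0) * poly r t" unfolding r by (simp add: algebra_simps)
      then show ?thesis using t0(2)[OF that] by (simp add: m_def)
    qed
    have "weighted_nonneg ([:-t0, 1:] * r)"
    proof (cases "t0 = 0")
      case True
      have gap: "0 \<le> poly r t" if "t \<in> {0..M}" "t \<noteq> t0" for t
        using r_val[OF that(1)] that True nonneg_of_pos_mult[of t "poly r t"] by simp
      have "0 \<le> poly r t" if "t \<in> {0..M}" for t
        using gap poly_nonneg_at_excluded_point[OF t0(1) gap] that by blast
      then have "weighted_nonneg r" using deg_r by (intro less.hyps) auto
      then show ?thesis using True weighted_nonneg_mult(1) by simp
    next
      case nz: False
      show ?thesis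
      proof (cases "t0 = M")
        case True
        have gap: "0 \<le> poly (- r) t" if "t \<in> {0..M}" "t \<noteq> t0" for t
        proof (rule nonneg_of_pos_mult)
          show "0 \<le> (M - t) * poly (- r) t" using r_val[OF that(1)] True by (simp add: algebra_simps)
          show "0 < M - t" using that True by simp
        qed
        have "0 \<le> poly (- r) t" if "t \<in> {0..M}" for t
          using gap poly_nonneg_at_excluded_point[OF t0(1) gap] that by blast
        then have "weighted_nonneg (- r)" using deg_r by (intro less.hyps) auto
        then have "weighted_nonneg ([:M, -1:] * (- r))" by (rule weighted_nonneg_mult)
        moreover have "[:M, -1:] * (- r) = [:-t0, 1:] * r" using True by simp
        ultimately show ?thesis by metis
      next
        case False
        then have int: "0 < t0" "t0 < M" using nz t0(1) by auto
        have "poly (pderiv q) t0 = 0"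
        proof (rule DERIV_local_min[OF poly_DERIV])
          show "0 < min t0 (M - t0)" using int by simp
          show "\<forall>y. \<bar>t0 - y\<bar> < min t0 (M - t0) \<longrightarrow> poly q t0 \<le> poly q y"
            by (intro allI impI t0(2)) (auto simp: abs_if split: if_splits)
        qed
        moreover have "pderiv q = pderiv ([:-t0, 1:] * r)"
          unfolding r[symmetric] by (simp add: pderiv_diff pderiv_pCons)
        moreover have "poly (pderiv ([:-t0, 1:] * r)) t0 = poly r t0"
          unfolding pderiv_mult by (simp add: pderiv_pCons)
        ultimately have "poly r t0 = 0" by metis
        then obtain h where h: "r = [:-t0, 1:] * h" by (metis poly_eq_0_iff_dvd dvdE)
        have gap: "0 \<le> poly h t" if "t \<in> {0..M}" "t \<noteq> t0" for t
        proof -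
          have "0 \<le> (t - t0)\<^sup>2 * poly h t"
            using r_val[OF that(1)] unfolding h by (simp add: power2_eq_square algebra_simps)
          then show ?thesis using that(2) nonneg_of_pos_mult[of "(t - t0)\<^sup>2" "poly h t"] by simp
        qed
        have "0 \<le> poly h t" if "t \<in> {0..M}" for t
          using gap poly_nonneg_at_excluded_point[OF t0(1) gap] that by blast
        moreover have "degree h < degree q"
          using deg_r r0 unfolding h by (subst (asm) degree_mult_eq) auto
        ultimately have "weighted_nonneg h" by (intro less.hyps) auto
        then have "weighted_nonneg ([:-t0, 1:] * [:-t0, 1:] * h)" by (rule weighted_nonneg_mult)
        then show ?thesis unfolding h by (simp only: mult.assoc)
      qed
    qed
    then have "weighted_nonneg ([:m:] + (q - [:m:]))"
      unfolding r by (intro weighted_nonneg_add weighted_nonneg_const m)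
    moreover have "[:m:] + (q - [:m:]) = q" by simp
    ultimately show ?thesis by metis
  qed
qed

text \<open>If \<open>|p| \<le> c\<close>, then \<open>c\<^sup>2 - p\<^sup>2 \<ge> 0\<close>, and the form of \<open>c\<^sup>2 - p(A)\<^sup>2\<close> at \<open>x\<close> is
  \<open>c\<^sup>2\<parallel>x\<parallel>\<^sup>2 - \<parallel>p(A)x\<parallel>\<^sup>2\<close>.\<close>

lemma norm_poly_op_le_of_bound:
  assumes "\<And>t. t \<in> {0..M} \<Longrightarrow> \<bar>poly p t\<bar> \<le> c"
  shows "norm (poly_op p A) \<le> c"
proof (rule norm_blinfun_bound)
  show c: "0 \<le> c" using assms[of 0] M(1) by (simp add: order_trans[OF abs_ge_zero])
  fix x
  have "weighted_nonneg ([:c\<^sup>2:] - p * p)"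
    by (rule nonneg_imp_weighted_nonneg)
      (use assms c in \<open>auto simp: power2_eq_square[symmetric] abs_le_square_iff[symmetric]\<close>)
  then have "0 \<le> Re (cinner (poly_op ([:c\<^sup>2:] - p * p) A x) x)"
    by (simp add: weighted_nonneg_def form_nonneg_def)
  also have "\<dots> = (c * norm x)\<^sup>2 - (norm (poly_op p A x))\<^sup>2"
    by (simp add: poly_op_diff poly_op_mult_apply blinfun.diff_left cinner_simps norm_sq_eq
        selfadjointD[OF selfadjoint_poly_op[OF selfadjoint_A]] power_mult_distrib)
  finally have "(norm (poly_op p A x))\<^sup>2 \<le> (c * norm x)\<^sup>2" by linarith
  then show "norm (poly_op p A x) \<le> c * norm x"
    by (rule power2_le_imp_le) (simp add: c)
qed

end

text \<open>For \<open>A = 0\<close> the interval degenerates to a point, where the division argument breaks down; there \<open>p(A)\<close> is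
  the scalar \<open>p(0)\<close>.\<close>

lemma norm_poly_op_le:
  assumes "positive_op A" "\<And>t. t \<in> {0..norm A} \<Longrightarrow> \<bar>poly p t\<bar> \<le> c"
  shows "norm (poly_op p (A :: 'a :: separable_hilbert \<Rightarrow>\<^sub>L 'a)) \<le> c"
proof (cases "A = 0")
  case True
  have p: "poly_op p A = poly p 0 *\<^sub>R id_blinfun"
  proof (rule blinfun_eqI)
    fix x
    obtain a q where q: "p = pCons a q" by (cases p)
    show "poly_op p A x = (poly p 0 *\<^sub>R id_blinfun) x"
      unfolding q by (simp add: poly_op_pCons_apply True blinfun.scaleR_left)
  qed
  have "norm (poly_op p A) \<le> \<bar>poly p 0\<bar>"
    by (rule norm_blinfun_bound) (simp_all add: p blinfun.scaleR_left)
  also have "\<dots> \<le> c" using assms(2)[of 0] by simp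
  finally show ?thesis .
next
  case False
  then show ?thesis using assms by (intro norm_poly_op_le_of_bound[of A "norm A"]) auto
qed

definition power_fun :: "real \<Rightarrow> real \<Rightarrow> real" where
  "power_fun r t = (if r = 0 then 1 else t powr r)"

lemma continuous_on_power_fun: "0 \<le> r \<Longrightarrow> continuous_on {0..b} (power_fun r)"
  unfolding power_fun_def by (cases "r = 0") (auto intro!: continuous_on_powr' continuous_on_id)

lemma power_fun_add: "0 \<le> r \<Longrightarrow> 0 \<le> s \<Longrightarrow> 0 \<le> t \<Longrightarrow> power_fun (r + s) t = power_fun r t * power_fun s t"
  by (auto simp: power_fun_def powr_add)

lemma polynomials_converging_to:
  fixes f :: "real \<Rightarrow> real"
  assumes "continuous_on {0..b} f"
  shows "\<exists>p :: nat \<Rightarrow> real poly. uniform_limit {0..b} (\<lambda>n t. poly (p n) t) f sequentially"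
proof -
  have "\<exists>p :: real poly. \<forall>t\<in>{0..b}. \<bar>f t - poly p t\<bar> < inverse (real (Suc n))" for n
  proof -
    obtain h where h: "real_polynomial_function h" "\<And>t. t \<in> {0..b} \<Longrightarrow> \<bar>f t - h t\<bar> < inverse (real (Suc n))"
      using Stone_Weierstrass_real_polynomial_function[OF compact_Icc assms, of "inverse (real (Suc n))"]
      by auto
    obtain a N where "h = (\<lambda>x. \<Sum>i\<le>N. a i * x ^ i)"
      using h(1) unfolding real_polynomial_function_iff_sum by blast
    then have "h t = poly (\<Sum>i\<le>N. monom (a i) i) t" for t
      by (simp add: poly_sum poly_monom)
    then show ?thesis using h(2) by metis
  qed
  then obtain p :: "nat \<Rightarrow> real poly"
    where p: "\<And>n t. t \<in> {0..b} \<Longrightarrow> \<bar>f t - poly (p n) t\<bar> < inverse (real (Suc n))" by metis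
  have "uniform_limit {0..b} (\<lambda>n t. poly (p n) t) f sequentially"
  proof (rule uniform_limitI)
    fix e :: real assume "e > 0"
    then have "eventually (\<lambda>n. inverse (real (Suc n)) < e) sequentially"
      using LIMSEQ_inverse_real_of_nat by (simp add: order_tendsto_iff)
    then show "\<forall>\<^sub>F n in sequentially. \<forall>t\<in>{0..b}. dist (poly (p n) t) (f t) < e"
    proof eventually_elim
      case (elim n)
      show ?case
      proof
        fix t assume "t \<in> {0..b}"
        from p[OF this, of n] elim show "dist (poly (p n) t) (f t) < e"
          unfolding dist_real_def by linarith
      qed
    qed
  qed
  then show ?thesis by blast
qed

context
  fixes A :: "'a :: separable_hilbert \<Rightarrow>\<^sub>L 'a"
  assumes A: "positive_op A"
begin

lemma poly_op_uniform_limit_zero: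
  assumes "uniform_limit {0..norm A} (\<lambda>n t. poly (p n) t) (\<lambda>t. 0) sequentially"
  shows "(\<lambda>n. poly_op (p n) A) \<longlonglongrightarrow> 0"
proof (rule tendstoI)
  fix e :: real assume "e > 0"
  then have "\<forall>\<^sub>F n in sequentially. \<forall>t\<in>{0..norm A}. dist (poly (p n) t) 0 < e/2"
    by (intro uniform_limitD[OF assms]) simp
  then show "\<forall>\<^sub>F n in sequentially. dist (poly_op (p n) A) 0 < e"
  proof eventually_elim
    case (elim n)
    then have "norm (poly_op (p n) A) \<le> e/2"
      by (intro norm_poly_op_le[OF A]) (auto simp: less_imp_le)
    then show ?case using \<open>e > 0\<close> by simp
  qed
qed

lemma poly_op_uniform_limit_Cauchy:
  assumes "uniform_limit {0..norm A} (\<lambda>n t. poly (p n) t) f sequentially"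
  shows "Cauchy (\<lambda>n. poly_op (p n) A)"
proof (rule metric_CauchyI)
  fix e :: real assume e: "e > 0"
  then have "\<forall>\<^sub>F n in sequentially. \<forall>t\<in>{0..norm A}. dist (poly (p n) t) (f t) < e/4"
    by (intro uniform_limitD[OF assms]) simp
  then obtain N where N: "\<And>n t. n \<ge> N \<Longrightarrow> t \<in> {0..norm A} \<Longrightarrow> dist (poly (p n) t) (f t) < e/4"
    unfolding eventually_sequentially by blast
  have "dist (poly_op (p m) A) (poly_op (p n) A) < e" if "m \<ge> N" "n \<ge> N" for m n
  proof -
    have "norm (poly_op (p m - p n) A) \<le> e/2"
    proof (rule norm_poly_op_le[OF A])
      fix t assume "t \<in> {0..norm A}"
      then show "\<bar>poly (p m - p n) t\<bar> \<le> e/2"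
        using N[OF that(1), of t] N[OF that(2), of t] unfolding dist_real_def poly_diff by linarith
    qed
    then show ?thesis using e by (simp add: dist_norm poly_op_diff)
  qed
  then show "\<exists>M. \<forall>m\<ge>M. \<forall>n\<ge>M. dist (poly_op (p m) A) (poly_op (p n) A) < e" by blast
qed

text \<open>Polynomials with the same uniform limit have operator limits that agree, by the norm bound for their
  difference. Weierstrass approximation supplies at least one such sequence; without it the
  definite description of the power would not be determined.\<close>

lemma op_powr_limit:
  assumes "0 \<le> r" "uniform_limit {0..norm A} (\<lambda>n t. poly (p n) t) (power_fun r) sequentially"
  shows "(\<lambda>n. poly_op (p n) A) \<longlonglongrightarrow> op_powr A r"
proof -
  obtain q :: "nat \<Rightarrow> real poly"
    where q: "uniform_limit {0..norm A} (\<lambda>n t. poly (q n) t) (power_fun r) sequentially"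
    using polynomials_converging_to[OF continuous_on_power_fun[OF assms(1)]] by blast
  obtain T where T: "(\<lambda>n. poly_op (q n) A) \<longlonglongrightarrow> T"
    using Cauchy_convergent[OF poly_op_uniform_limit_Cauchy[OF q]] convergent_def by blast
  have all: "(\<lambda>n. poly_op (q' n) A) \<longlonglongrightarrow> T"
    if q': "uniform_limit {0..norm A} (\<lambda>n t. poly (q' n) t) (power_fun r) sequentially" for q'
  proof -
    have "uniform_limit {0..norm A} (\<lambda>n t. poly (q' n - q n) t) (\<lambda>t. 0) sequentially"
      using uniform_limit_minus[OF q' q] by simp
    then have "(\<lambda>n. poly_op (q' n - q n) A) \<longlonglongrightarrow> 0" by (rule poly_op_uniform_limit_zero)
    then have "(\<lambda>n. (poly_op (q' n) A - poly_op (q n) A) + poly_op (q n) A) \<longlonglongrightarrow> 0 + T"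
      unfolding poly_op_diff by (rule tendsto_add[OF _ T])
    then show ?thesis by simp
  qed
  have "op_powr A r = T"
    unfolding op_powr_def power_fun_def[symmetric]
  proof (rule the_equality)
    fix T' assume "\<forall>p. uniform_limit {0..norm A} (\<lambda>n t. poly (p n) t) (\<lambda>t. power_fun r t) sequentially
      \<longrightarrow> (\<lambda>n. poly_op (p n) A) \<longlonglongrightarrow> T'"
    then show "T' = T" using q T LIMSEQ_unique by blast
  qed (use all in blast)
  then show ?thesis using all[OF assms(2)] by simp
qed

lemma op_powr_approx:
  assumes "0 \<le> r"
  obtains p :: "nat \<Rightarrow> real poly"
  where "uniform_limit {0..norm A} (\<lambda>n t. poly (p n) t) (power_fun r) sequentially"
    and "(\<lambda>n. poly_op (p n) A) \<longlonglongrightarrow> op_powr A r"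
  using polynomials_converging_to[OF continuous_on_power_fun[OF assms]] op_powr_limit[OF assms] by blast

text \<open>If \<open>p\<^sub>n\<close> and \<open>q\<^sub>n\<close> approximate the two powers, then \<open>p\<^sub>nq\<^sub>n\<close> approximates their product, the power with
  the summed exponent.\<close>

lemma op_powr_add:
  assumes "0 \<le> r" "0 \<le> s"
  shows "op_powr A (r + s) = op_powr A r o\<^sub>L op_powr A s"
proof -
  obtain p where p: "uniform_limit {0..norm A} (\<lambda>n t. poly (p n) t) (power_fun r) sequentially"
    and p': "(\<lambda>n. poly_op (p n) A) \<longlonglongrightarrow> op_powr A r" using op_powr_approx[OF assms(1)] .
  obtain q where q: "uniform_limit {0..norm A} (\<lambda>n t. poly (q n) t) (power_fun s) sequentially"
    and q': "(\<lambda>n. poly_op (q n) A) \<longlonglongrightarrow> op_powr A s" using op_powr_approx[OF assms(2)] .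
  have bdd: "bounded (power_fun r ` {0..norm A})" if "0 \<le> r" for r
    by (intro compact_imp_bounded compact_continuous_image continuous_on_power_fun that) simp
  have "uniform_limit {0..norm A} (\<lambda>n t. poly (p n) t * poly (q n) t) (\<lambda>t. power_fun r t * power_fun s t) sequentially"
    by (intro uniform_lim_mult p q bdd assms)
  then have "uniform_limit {0..norm A} (\<lambda>n t. poly (p n * q n) t) (power_fun (r + s)) sequentially"
    by (rule uniform_limit_cong'[THEN iffD1, rotated -1])
      (use assms power_fun_add in auto)
  then have "(\<lambda>n. poly_op (p n * q n) A) \<longlonglongrightarrow> op_powr A (r + s)"
    using assms by (intro op_powr_limit) auto
  moreover have "(\<lambda>n. poly_op (p n * q n) A) = (\<lambda>n. poly_op (p n) A o\<^sub>L poly_op (q n) A)"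
    by (intro ext blinfun_eqI) (simp add: poly_op_mult_apply)
  moreover have "(\<lambda>n. poly_op (p n) A o\<^sub>L poly_op (q n) A) \<longlonglongrightarrow> (op_powr A r o\<^sub>L op_powr A s)"
    by (intro bounded_bilinear.tendsto[OF bounded_bilinear_blinfun_compose] p' q')
  ultimately show ?thesis by (simp add: LIMSEQ_unique)
qed

lemma op_powr_1: "op_powr A 1 = A"
proof -
  have "uniform_limit {0..norm A} (\<lambda>n t. poly [:0, 1:] t) (power_fun 1) sequentially"
    by (rule uniform_limitI) (auto simp: power_fun_def)
  then have "(\<lambda>n. poly_op [:0, 1:] A) \<longlonglongrightarrow> op_powr A 1" by (intro op_powr_limit) auto
  then have "op_powr A 1 = poly_op [:0, 1:] A" by (simp add: LIMSEQ_const_iff)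
  also have "\<dots> = A" by (rule blinfun_eqI) (simp add: poly_op_pCons_apply)
  finally show ?thesis .
qed

lemma op_powr_selfadjoint:
  assumes "0 \<le> r"
  shows "selfadjoint (op_powr A r)"
  unfolding selfadjoint_def
proof (intro allI)
  fix x y
  obtain p where p: "(\<lambda>n. poly_op (p n) A) \<longlonglongrightarrow> op_powr A r" using op_powr_approx[OF assms] .
  have lim: "(\<lambda>n. cinner (poly_op (p n) A z) w) \<longlonglongrightarrow> cinner (op_powr A r z) w" for z w
    by (intro bounded_linear.tendsto[OF bounded_linear_cinner_left] blinfun.tendsto p tendsto_const)
  have "(\<lambda>n. cnj (cinner (poly_op (p n) A y) x)) \<longlonglongrightarrow> cnj (cinner (op_powr A r y) x)"
    by (intro tendsto_cnj lim)
  moreover have "(\<lambda>n. cnj (cinner (poly_op (p n) A y) x)) = (\<lambda>n. cinner (poly_op (p n) A x) y)"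
    using selfadjointD[OF selfadjoint_poly_op[OF positive_op_selfadjoint[OF A]]]
    by (intro ext) (metis cinner_commute)
  ultimately have "(\<lambda>n. cinner (poly_op (p n) A x) y) \<longlonglongrightarrow> cnj (cinner (op_powr A r y) x)" by simp
  then have "cinner (op_powr A r x) y = cnj (cinner (op_powr A r y) x)"
    by (rule LIMSEQ_unique[OF lim])
  then show "cinner (op_powr A r x) y = cinner x (op_powr A r y)" by (metis cinner_commute)
qed

text \<open>An operator with an adjoint is complex linear.\<close>

lemma op_powr_clinear:
  assumes "0 \<le> r"
  shows "is_clinear (op_powr A r)"
  unfolding is_clinear_def
proof (intro allI)
  fix c x
  have sa: "cinner (op_powr A r z) y = cinner z (op_powr A r y)" for y z
    by (rule selfadjointD[OF op_powr_selfadjoint[OF assms]])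
  show "op_powr A r (c *\<^sub>C x) = c *\<^sub>C op_powr A r x"
    by (rule cinner_eq_all_Re) (simp add: sa[symmetric] cinner_scaleC_right)
qed

lemma norm_op_powr_le:
  assumes "0 \<le> r" "r \<le> 1"
  shows "norm (op_powr A r) \<le> max 1 (norm A)"
proof -
  obtain p where p: "uniform_limit {0..norm A} (\<lambda>n t. poly (p n) t) (power_fun r) sequentially"
    and p': "(\<lambda>n. poly_op (p n) A) \<longlonglongrightarrow> op_powr A r" using op_powr_approx[OF assms(1)] .
  have bd: "\<bar>power_fun r t\<bar> \<le> max 1 (norm A)" if "t \<in> {0..norm A}" for t
  proof -
    have "t powr r \<le> max 1 (norm A) powr r" using that assms by (intro powr_mono2) auto
    also have "\<dots> \<le> max 1 (norm A) powr 1" using assms by (intro powr_mono) auto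
    finally show ?thesis by (auto simp: power_fun_def)
  qed
  show ?thesis
  proof (rule field_le_epsilon)
    fix e :: real assume e: "e > 0"
    have "\<forall>\<^sub>F n in sequentially. norm (poly_op (p n) A) \<le> max 1 (norm A) + e"
      using uniform_limitD[OF p e]
    proof eventually_elim
      case (elim n)
      show ?case
      proof (rule norm_poly_op_le[OF A])
        fix t assume t: "t \<in> {0..norm A}"
        then have "\<bar>poly (p n) t - power_fun r t\<bar> < e" using elim by (auto simp: dist_real_def)
        then show "\<bar>poly (p n) t\<bar> \<le> max 1 (norm A) + e" using bd[OF t] by linarith
      qed
    qed
    then show "norm (op_powr A r) \<le> max 1 (norm A) + e"
      by (intro tendsto_upperbound[OF tendsto_norm[OF p']]) auto
  qed
qed

end

section \<open>Singular systems of compact operators\<close>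

lemma compact_op_clinear: "compact_op T \<Longrightarrow> is_clinear T"
  by (simp add: compact_op_def)

lemma compact_op_convergent_subseq:
  assumes "compact_op T" "\<And>n. norm (x n) \<le> 1"
  obtains l r where "strict_mono (r :: nat \<Rightarrow> nat)" "(\<lambda>n. blinfun_apply T (x (r n))) \<longlonglongrightarrow> l"
proof -
  have "seq_compact (closure (blinfun_apply T ` cball 0 1))"
    using assms(1) by (simp add: compact_op_def compact_eq_seq_compact_metric)
  moreover have "T (x n) \<in> closure (blinfun_apply T ` cball 0 1)" for n
    by (rule subsetD[OF closure_subset]) (use assms(2) in auto)
  ultimately obtain l r where "strict_mono (r :: nat \<Rightarrow> nat)" "((\<lambda>n. T (x n)) \<circ> r) \<longlonglongrightarrow> l"
    unfolding seq_compact_def by metis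
  then show thesis using that by (simp add: o_def)
qed

text \<open>The norm of the restriction of \<open>T\<close> to the orthogonal complement of \<open>F\<close>. If \<open>F\<close> consists of the first
  \<open>n\<close> Schmidt vectors, this is the singular value with index \<open>n\<close>.\<close>

definition sup_norm_off :: "('a :: complex_inner \<Rightarrow>\<^sub>L 'a) \<Rightarrow> 'a set \<Rightarrow> real" where
  "sup_norm_off T F = Sup ((\<lambda>x. norm (blinfun_apply T x)) ` {x. norm x \<le> 1 \<and> (\<forall>f\<in>F. cinner x f = 0)})"

lemma bdd_above_norm_image: "bdd_above ((\<lambda>x. norm (blinfun_apply T x)) ` {x. norm x \<le> 1 \<and> P x})"
proof (rule bdd_aboveI2)
  fix x assume "x \<in> {x. norm x \<le> 1 \<and> P x}"
  then have x: "norm x \<le> 1" by simp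
  have "norm (T x) \<le> norm T * norm x" by (rule norm_blinfun)
  also have "\<dots> \<le> norm T * 1" by (intro mult_left_mono x) simp
  finally show "norm (T x) \<le> norm T" by simp
qed

lemma norm_le_sup_norm_off_unit:
  assumes "norm x \<le> 1" "\<And>f. f \<in> F \<Longrightarrow> cinner x f = 0"
  shows "norm (blinfun_apply T x) \<le> sup_norm_off T F"
  unfolding sup_norm_off_def by (intro cSup_upper[OF _ bdd_above_norm_image]) (use assms in auto)

lemma sup_norm_off_nonneg: "0 \<le> sup_norm_off T F"
  using norm_le_sup_norm_off_unit[of 0 F T] by (simp add: blinfun.zero_right)

lemma norm_le_sup_norm_off:
  assumes "\<And>f. f \<in> F \<Longrightarrow> cinner x f = 0"
  shows "norm (blinfun_apply T x) \<le> sup_norm_off T F * norm x"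
proof (cases "x = 0")
  case False
  have "norm (T ((1 / norm x) *\<^sub>R x)) \<le> sup_norm_off T F"
    by (rule norm_le_sup_norm_off_unit) (use assms False in auto)
  then show ?thesis using False by (simp add: blinfun.scaleR_right field_simps)
qed (simp add: blinfun.zero_right)

lemma sup_norm_off_mono: "F \<subseteq> F' \<Longrightarrow> sup_norm_off T F' \<le> sup_norm_off T F"
  unfolding sup_norm_off_def
proof (intro cSup_subset_mono bdd_above_norm_image)
  have "0 \<in> {x. norm x \<le> 1 \<and> (\<forall>f\<in>F'. cinner x f = 0)}" by simp
  then show "(\<lambda>x. norm (T x)) ` {x. norm x \<le> 1 \<and> (\<forall>f\<in>F'. cinner x f = 0)} \<noteq> {}" by blast
qed auto

text \<open>For a maximising sequence \<open>x\<^sub>n\<close> in the unit ball one has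
  \<open>\<parallel>T\<^sup>*Tx\<^sub>n - \<sigma>\<^sup>2x\<^sub>n\<parallel>\<^sup>2 \<le> \<sigma>\<^sup>2(\<sigma>\<^sup>2 - \<parallel>Tx\<^sub>n\<parallel>\<^sup>2) \<rightarrow> 0\<close>, where invariance of the complement of \<open>F\<close> under \<open>T\<^sup>*T\<close> is
  used. By compactness \<open>T\<^sup>*Tx\<^sub>n\<close>, hence also \<open>x\<^sub>n\<close>, has a convergent subsequence, and its limit is the
  required eigenvector.\<close>

lemma sup_norm_off_attained:
  fixes T :: "'a :: separable_hilbert \<Rightarrow>\<^sub>L 'a"
  assumes T: "compact_op T"
    and F: "\<And>f. f \<in> F \<Longrightarrow> \<exists>c. adj T (blinfun_apply T f) = c *\<^sub>R f"
  shows "\<exists>v. (\<forall>f\<in>F. cinner v f = 0) \<and> norm v = (if sup_norm_off T F = 0 then 0 else 1) \<and>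
           adj T (blinfun_apply T v) = (sup_norm_off T F)\<^sup>2 *\<^sub>R v"
proof (cases "sup_norm_off T F = 0")
  case True
  then show ?thesis by (intro exI[of _ 0]) (simp add: blinfun.zero_right)
next
  case False
  define \<sigma> where "\<sigma> = sup_norm_off T F"
  have \<sigma>: "\<sigma> > 0" using False sup_norm_off_nonneg[of T F] by (simp add: \<sigma>_def)
  note lin = compact_op_clinear[OF T]
  let ?B = "{x. norm x \<le> 1 \<and> (\<forall>f\<in>F. cinner x f = 0)}"
  have "\<exists>x\<in>?B. norm (T x) > \<sigma> - inverse (real (Suc n))" for n
  proof -
    have "0 \<in> ?B" by simp
    then have "(\<lambda>x. norm (T x)) ` ?B \<noteq> {}" by blast
    then have "\<exists>y\<in>(\<lambda>x. norm (T x)) ` ?B. \<sigma> - inverse (real (Suc n)) < y"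
      by (rule less_cSupD) (simp add: \<sigma>_def sup_norm_off_def[symmetric])
    then show ?thesis by blast
  qed
  then obtain x where x: "\<And>n. norm (x n) \<le> 1" "\<And>n f. f \<in> F \<Longrightarrow> cinner (x n) f = 0"
    "\<And>n. norm (T (x n)) > \<sigma> - inverse (real (Suc n))" by (simp add: Bex_def) metis
  obtain l r where r: "strict_mono (r :: nat \<Rightarrow> nat)" and l: "(\<lambda>n. T (x (r n))) \<longlonglongrightarrow> l"
    using compact_op_convergent_subseq[OF T x(1)] .
  have Tx_le: "norm (T (x n)) \<le> \<sigma>" for n
    unfolding \<sigma>_def using x by (intro norm_le_sup_norm_off_unit) auto
  have "(\<lambda>n. norm (T (x n))) \<longlonglongrightarrow> \<sigma>"
  proof (rule tendsto_sandwich)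
    show "(\<lambda>n. \<sigma> - inverse (real (Suc n))) \<longlonglongrightarrow> \<sigma>"
      using tendsto_diff[OF tendsto_const[of \<sigma>] LIMSEQ_inverse_real_of_nat] by simp
    show "\<forall>\<^sub>F n in sequentially. \<sigma> - inverse (real (Suc n)) \<le> norm (T (x n))"
      using x(3) by (intro always_eventually allI less_imp_le)
    show "\<forall>\<^sub>F n in sequentially. norm (T (x n)) \<le> \<sigma>"
      using Tx_le by (intro always_eventually allI)
  qed (rule tendsto_const)
  then have norm_lim: "(\<lambda>n. norm (T (x (r n)))) \<longlonglongrightarrow> \<sigma>"
    using LIMSEQ_subseq_LIMSEQ[OF _ r] by (simp add: o_def)
  have defect: "(norm (adj T (T (x n)) - \<sigma>\<^sup>2 *\<^sub>R x n))\<^sup>2 \<le> \<sigma>\<^sup>2 * (\<sigma>\<^sup>2 - (norm (T (x n)))\<^sup>2)" for n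
  proof -
    define y where "y = adj T (T (x n))"
    have "cinner y f = 0" if f: "f \<in> F" for f
    proof -
      obtain c where "adj T (T f) = c *\<^sub>R f" using F[OF f] by blast
      then have "cinner y f = c * cinner (x n) f"
        by (simp add: y_def cinner_adj'[OF lin] cinner_adj[OF lin])
      then show ?thesis using x(2)[OF f] by simp
    qed
    then have Ty: "norm (T y) \<le> \<sigma> * norm y" unfolding \<sigma>_def by (intro norm_le_sup_norm_off)
    have "(norm y)\<^sup>2 = Re (cinner (T (x n)) (T y))"
      unfolding norm_sq_eq by (simp add: y_def cinner_adj'[OF lin])
    also have "\<dots> \<le> norm (T (x n)) * norm (T y)" by (rule Re_cinner_le)
    also have "\<dots> \<le> norm (T (x n)) * (\<sigma> * norm y)" by (intro mult_left_mono Ty) simp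
    finally have "norm y * norm y \<le> (\<sigma> * norm (T (x n))) * norm y"
      by (simp add: power2_eq_square mult_ac)
    then have "norm y \<le> \<sigma> * norm (T (x n))"
      using \<sigma> by (cases "y = 0") auto
    then have y_sq: "(norm y)\<^sup>2 \<le> \<sigma>\<^sup>2 * (norm (T (x n)))\<^sup>2"
      by (metis norm_ge_zero power_mono power_mult_distrib)
    have inner: "Re (cinner y (x n)) = (norm (T (x n)))\<^sup>2"
      by (simp add: y_def cinner_adj'[OF lin] norm_sq_eq)
    have "(norm (x n))\<^sup>2 \<le> 1" using x(1)[of n] by (simp add: power_le_one)
    then have "\<sigma>\<^sup>2 * \<sigma>\<^sup>2 * (norm (x n))\<^sup>2 \<le> \<sigma>\<^sup>2 * \<sigma>\<^sup>2 * 1" by (intro mult_left_mono) auto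
    moreover have "(norm (y - \<sigma>\<^sup>2 *\<^sub>R x n))\<^sup>2
        = (norm y)\<^sup>2 - 2 * \<sigma>\<^sup>2 * (norm (T (x n)))\<^sup>2 + \<sigma>\<^sup>2 * \<sigma>\<^sup>2 * (norm (x n))\<^sup>2"
      unfolding norm_sq_diff cinner_scaleR_right
      by (simp add: inner power_mult_distrib power2_eq_square)
    ultimately show ?thesis unfolding y_def[symmetric] using y_sq by (simp add: algebra_simps)
  qed
  have "(\<lambda>n. norm (adj T (T (x (r n))) - \<sigma>\<^sup>2 *\<^sub>R x (r n))) \<longlonglongrightarrow> 0"
  proof -
    have "(\<lambda>n. \<sigma>\<^sup>2 * (\<sigma>\<^sup>2 - (norm (T (x (r n))))\<^sup>2)) \<longlonglongrightarrow> \<sigma>\<^sup>2 * (\<sigma>\<^sup>2 - \<sigma>\<^sup>2)"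
      by (intro tendsto_intros norm_lim)
    then have bound: "(\<lambda>n. \<sigma>\<^sup>2 * (\<sigma>\<^sup>2 - (norm (T (x (r n))))\<^sup>2)) \<longlonglongrightarrow> 0" by simp
    have "(\<lambda>n. (norm (adj T (T (x (r n))) - \<sigma>\<^sup>2 *\<^sub>R x (r n)))\<^sup>2) \<longlonglongrightarrow> 0"
      by (rule tendsto_sandwich[OF _ _ tendsto_const bound])
        (intro always_eventually allI zero_le_power2 defect)+
    then have "(\<lambda>n. sqrt ((norm (adj T (T (x (r n))) - \<sigma>\<^sup>2 *\<^sub>R x (r n)))\<^sup>2)) \<longlonglongrightarrow> sqrt 0"
      by (rule tendsto_real_sqrt)
    then show ?thesis by simp
  qed
  then have "(\<lambda>n. adj T (T (x (r n))) - \<sigma>\<^sup>2 *\<^sub>R x (r n)) \<longlonglongrightarrow> 0" by (rule tendsto_norm_zero_cancel)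
  then have "(\<lambda>n. adj T (T (x (r n))) - (adj T (T (x (r n))) - \<sigma>\<^sup>2 *\<^sub>R x (r n))) \<longlonglongrightarrow> adj T l - 0"
    by (intro tendsto_diff blinfun.tendsto tendsto_const l)
  then have "(\<lambda>n. inverse (\<sigma>\<^sup>2) *\<^sub>R (\<sigma>\<^sup>2 *\<^sub>R x (r n))) \<longlonglongrightarrow> inverse (\<sigma>\<^sup>2) *\<^sub>R adj T l"
    by (intro tendsto_intros) simp
  then obtain v where v: "(\<lambda>n. x (r n)) \<longlonglongrightarrow> v" using \<sigma> by auto
  have v_orth: "cinner v f = 0" if "f \<in> F" for f
  proof -
    have "(\<lambda>n. cinner (x (r n)) f) \<longlonglongrightarrow> cinner v f"
      by (intro bounded_linear.tendsto[OF bounded_linear_cinner_left] v)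
    then show ?thesis using x(2)[OF that] by (simp add: LIMSEQ_const_iff)
  qed
  have "(\<lambda>n. norm (T (x (r n)))) \<longlonglongrightarrow> norm (T v)"
    by (intro tendsto_norm blinfun.tendsto tendsto_const v)
  then have Tv: "norm (T v) = \<sigma>" using norm_lim LIMSEQ_unique by blast
  have "norm v \<le> 1"
    using tendsto_norm[OF v] by (rule LIMSEQ_le_const2) (use x(1) in auto)
  moreover have "\<sigma> \<le> \<sigma> * norm v"
    using norm_le_sup_norm_off[of F v T] v_orth Tv by (simp add: \<sigma>_def)
  ultimately have nv: "norm v = 1" using \<sigma> by simp
  have "(\<lambda>n. adj T (T (x (r n))) - \<sigma>\<^sup>2 *\<^sub>R x (r n)) \<longlonglongrightarrow> adj T (T v) - \<sigma>\<^sup>2 *\<^sub>R v"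
    by (intro tendsto_intros blinfun.tendsto v)
  then have "adj T (T v) - \<sigma>\<^sup>2 *\<^sub>R v = 0"
    using \<open>(\<lambda>n. adj T (T (x (r n))) - \<sigma>\<^sup>2 *\<^sub>R x (r n)) \<longlonglongrightarrow> 0\<close> LIMSEQ_unique by blast
  then show ?thesis using v_orth nv False by (intro exI[of _ v]) (simp add: \<sigma>_def)
qed

text \<open>The last condition says that the expansion of \<open>T\<close> along \<open>v\<close>, broken off at \<open>n\<close>, has an error of norm at
  most \<open>s n\<close>. It replaces the completeness of \<open>v\<close> on the complement of the kernel of \<open>T\<close>.\<close>

definition singular_system :: "('a :: separable_hilbert \<Rightarrow>\<^sub>L 'a) \<Rightarrow> (nat \<Rightarrow> real) \<Rightarrow> (nat \<Rightarrow> 'a) \<Rightarrow> bool" where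
  "singular_system T s v \<longleftrightarrow> decseq s \<and> (\<forall>n. 0 \<le> s n) \<and> s \<longlonglongrightarrow> 0 \<and> orthonormal_or_zero v \<and>
     (\<forall>n. v n = 0 \<longleftrightarrow> s n = 0) \<and> (\<forall>n. adj T (blinfun_apply T (v n)) = (s n)\<^sup>2 *\<^sub>R v n) \<and>
     (\<forall>n x. (\<forall>k<n. cinner x (v k) = 0) \<longrightarrow> norm (blinfun_apply T x) \<le> s n * norm x)"

text \<open>The vectors are chosen one after the other as maximisers on the complement of their predecessors.
  The values tend to zero, since otherwise the \<open>Tv\<^sub>n\<close> would be orthogonal with norms bounded below and
  would have no convergent subsequence.\<close>

lemma singular_system_exists:
  fixes T :: "'a :: separable_hilbert \<Rightarrow>\<^sub>L 'a"
  assumes T: "compact_op T"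
  shows "\<exists>s v. singular_system T s v"
proof -
  define Q where "Q F v \<longleftrightarrow> (\<forall>f\<in>F. cinner v f = 0) \<and>
     norm v = (if sup_norm_off T F = 0 then 0 else 1) \<and>
     adj T (blinfun_apply T v) = (sup_norm_off T F)\<^sup>2 *\<^sub>R v" for F v
  define F where "F = rec_nat {} (\<lambda>_ F. insert (SOME v. Q F v) F)"
  define v where "v n = (SOME v. Q (F n) v)" for n
  define s where "s n = sup_norm_off T (F n)" for n
  have F0: "F 0 = {}" and FS: "F (Suc n) = insert (v n) (F n)" for n
    by (simp_all add: F_def v_def)
  have F_eq: "F n = v ` {..<n}" for n
    by (induction n) (auto simp: F0 FS lessThan_Suc)
  have inv: "(\<forall>f\<in>F n. \<exists>c. adj T (T f) = c *\<^sub>R f) \<and> Q (F n) (v n)" for n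
  proof (induction n)
    case 0
    show ?case
      unfolding v_def F0 by (intro conjI someI_ex[of "Q {}"])
        (use sup_norm_off_attained[OF T, of "{}"] in \<open>simp_all add: Q_def\<close>)
  next
    case (Suc n)
    then have 1: "\<forall>f\<in>F (Suc n). \<exists>c. adj T (T f) = c *\<^sub>R f" by (auto simp: FS Q_def)
    then have "\<exists>w. Q (F (Suc n)) w" unfolding Q_def by (intro sup_norm_off_attained[OF T]) blast
    then have "Q (F (Suc n)) (v (Suc n))" unfolding v_def by (rule someI_ex)
    with 1 show ?case by blast
  qed
  have v_orth: "cinner (v n) (v k) = 0" if "k < n" for k n
    using inv[of n] that by (auto simp: Q_def F_eq)
  have v_orth': "cinner (v i) (v j) = 0" if "i \<noteq> j" for i j
    using v_orth[of i j] v_orth[of j i] that cinner_commute[of "v i" "v j"]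
    by (metis complex_cnj_zero linorder_neqE_nat)
  have v_norm: "norm (v n) = (if s n = 0 then 0 else 1)" for n
    using inv[of n] by (simp add: Q_def s_def)
  have v_eig: "adj T (T (v n)) = (s n)\<^sup>2 *\<^sub>R v n" for n
    using inv[of n] by (simp add: Q_def s_def)
  have s0: "0 \<le> s n" for n by (simp add: s_def sup_norm_off_nonneg)
  have dec: "decseq s" unfolding s_def decseq_Suc_iff FS by (auto intro: sup_norm_off_mono)
  have on: "orthonormal_or_zero v" by (auto simp: orthonormal_or_zero_def v_orth' v_norm)
  have lim: "s \<longlonglongrightarrow> 0"
  proof -
    obtain L where L: "s \<longlonglongrightarrow> L" using decseq_convergent[OF dec, of 0] s0 by blast
    then have sL: "L \<le> s n" for n using dec by (rule decseq_ge[rotated])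
    have L0: "0 \<le> L" using L s0 by (meson LIMSEQ_le_const)
    have "L = 0"
    proof (rule ccontr)
      assume "L \<noteq> 0"
      then have Lp: "L > 0" using L0 by simp
      have nv: "norm (v n) = 1" for n using v_norm[of n] sL[of n] Lp by auto
      obtain r l where r: "strict_mono (r :: nat \<Rightarrow> nat)" "(\<lambda>n. T (v (r n))) \<longlonglongrightarrow> l"
        using compact_op_convergent_subseq[OF T, of v] nv by (metis order_refl)
      have far: "(norm (T (v i) - T (v j)))\<^sup>2 \<ge> L\<^sup>2" if "i \<noteq> j" for i j
      proof -
        have inner: "cinner (T (v i)) (T (v j)) = of_real ((s j)\<^sup>2) * cinner (v i) (v j)" for i j
          by (simp add: cinner_adj[OF compact_op_clinear[OF T]] v_eig)
        have norm_Tv: "(norm (T (v i)))\<^sup>2 = (s i)\<^sup>2" for i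
          unfolding norm_sq_eq inner by (simp add: cinner_self nv)
        have "(norm (T (v i) - T (v j)))\<^sup>2 = (s i)\<^sup>2 + (s j)\<^sup>2"
          unfolding norm_sq_diff norm_Tv by (simp add: inner v_orth'[OF that])
        also have "\<dots> \<ge> L\<^sup>2 + 0" using sL[of i] L0 by (intro add_mono power_mono) auto
        finally show ?thesis by simp
      qed
      have "Cauchy (\<lambda>n. T (v (r n)))" using r(2) by (rule LIMSEQ_imp_Cauchy)
      then obtain N where "\<forall>m\<ge>N. \<forall>n\<ge>N. dist (T (v (r m))) (T (v (r n))) < L"
        using Lp unfolding Cauchy_def by blast
      then have "norm (T (v (r N)) - T (v (r (Suc N)))) < L" by (simp add: dist_norm)
      then have "(norm (T (v (r N)) - T (v (r (Suc N)))))\<^sup>2 < L\<^sup>2" by (intro power_strict_mono) auto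
      moreover have "r N \<noteq> r (Suc N)" using strict_monoD[OF r(1), of N "Suc N"] by simp
      ultimately show False using far by fastforce
    qed
    then show ?thesis using L by simp
  qed
  have v0: "v n = 0 \<longleftrightarrow> s n = 0" for n
    using v_norm[of n] by (cases "s n = 0") auto
  have tail: "norm (T x) \<le> s n * norm x" if "\<forall>k<n. cinner x (v k) = 0" for n x
    unfolding s_def by (rule norm_le_sup_norm_off) (use that in \<open>auto simp: F_eq\<close>)
  have "singular_system T s v"
    unfolding singular_system_def
    by (intro conjI allI impI) (rule dec s0 lim on v0 v_eig tail; assumption)+
  then show ?thesis by blast
qed

text \<open>With \<open>R = |T|\<close>, an eigenvector \<open>x\<close> of \<open>R\<^sup>2 = T\<^sup>*T\<close> to \<open>l\<^sup>2\<close> gives \<open>y = Rx - lx\<close> with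
  \<open>Ry = -ly\<close>, and \<open>y\<close> vanishes because \<open>R\<close> is positive. Positivity of \<open>R\<close> comes from the fourth root
  of \<open>T\<^sup>*T\<close>, whose square is \<open>R\<close>.\<close>

lemma abs_op_eigenspace:
  fixes T :: "'a :: separable_hilbert \<Rightarrow>\<^sub>L 'a"
  assumes lin: "is_clinear T" and l: "0 < l"
  shows "blinfun_apply (abs_op T) x = l *\<^sub>R x \<longleftrightarrow> adj T (blinfun_apply T x) = l\<^sup>2 *\<^sub>R x"
proof -
  define C where "C = adj T o\<^sub>L T"
  have C_inner: "cinner (C y) z = cinner (T y) (T z)" for y z
    by (simp add: C_def cinner_adj'[OF lin])
  have C: "positive_op C"
    unfolding positive_op_def
  proof (intro conjI allI)
    show "is_clinear C" unfolding C_def by (intro is_clinear_compose is_clinear_adj lin)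
  qed (simp_all add: C_inner cinner_self)
  define R where "R = op_powr C (1/2)"
  have abs: "abs_op T = R" by (simp add: abs_op_def R_def C_def)
  have RR: "R (R y) = C y" for y
    using op_powr_add[OF C, of "1/2" "1/2"] op_powr_1[OF C]
    by (simp add: R_def) (metis blinfun_apply_blinfun_compose)
  have R_form: "0 \<le> Re (cinner (R y) y)" for y
  proof -
    define Q where "Q = op_powr C (1/4)"
    have "R = Q o\<^sub>L Q" using op_powr_add[OF C, of "1/4" "1/4"] by (simp add: R_def Q_def)
    then have "cinner (R y) y = cinner (Q y) (Q y)"
      using selfadjointD[OF op_powr_selfadjoint[OF C, of "1/4"]] by (simp add: Q_def)
    then show ?thesis by (simp add: cinner_self)
  qed
  show ?thesis
  proof
    assume "abs_op T x = l *\<^sub>R x"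
    then have "C x = l\<^sup>2 *\<^sub>R x"
      using RR[of x] by (simp add: abs blinfun.scaleR_right power2_eq_square)
    then show "adj T (T x) = l\<^sup>2 *\<^sub>R x" by (simp add: C_def)
  next
    assume "adj T (T x) = l\<^sup>2 *\<^sub>R x"
    then have Cx: "C x = l\<^sup>2 *\<^sub>R x" by (simp add: C_def)
    define y where "y = R x - l *\<^sub>R x"
    have "R y = - l *\<^sub>R y"
      by (simp add: y_def blinfun.diff_right blinfun.scaleR_right RR Cx power2_eq_square
          scaleR_diff_right)
    then have "0 \<le> - l * (norm y)\<^sup>2" using R_form[of y] by (simp add: norm_sq_eq)
    moreover have "l * (norm y)\<^sup>2 > 0" if "y \<noteq> 0" using that l by simp
    ultimately have "y = 0" by fastforce
    then show "abs_op T x = l *\<^sub>R x" by (simp add: abs y_def)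
  qed
qed

text \<open>An eigenvector to \<open>l\<close> is orthogonal to all \<open>v\<^sub>n\<close> with \<open>s\<^sub>n \<noteq> l\<close>. Subtracting its projection to the
  remaining, finitely many \<open>v\<^sub>n\<close> leaves an eigenvector orthogonal to the whole system; there \<open>T\<close>
  vanishes, so the remainder is zero and the \<open>v\<^sub>n\<close> with \<open>s\<^sub>n = l\<close> span the eigenspace.\<close>

lemma singular_system_eigenspace_dim:
  assumes T: "is_clinear T" and sys: "singular_system T s v" and l: "0 < l"
  shows "finite {n. s n = l}"
    and "card {n. s n = l} = cdim {x. blinfun_apply (abs_op T) x = l *\<^sub>R x}"
proof -
  interpret V: vector_space "scaleC :: complex \<Rightarrow> 'a \<Rightarrow> 'a" by (rule vector_space_scaleC)
  have lim: "s \<longlonglongrightarrow> 0" and on: "orthonormal_or_zero v" and s0: "\<And>n. 0 \<le> s n"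
    and v0: "\<And>n. v n = 0 \<longleftrightarrow> s n = 0"
    and eig: "\<And>n. adj T (T (v n)) = (s n)\<^sup>2 *\<^sub>R v n"
    and tail: "\<And>n x. (\<And>k. k < n \<Longrightarrow> cinner x (v k) = 0) \<Longrightarrow> norm (T x) \<le> s n * norm x"
    using sys by (auto simp: singular_system_def)
  let ?I = "{n. s n = l}"
  have "eventually (\<lambda>n. s n < l) sequentially" using lim l by (simp add: order_tendsto_iff)
  then obtain N where "\<And>n. n \<ge> N \<Longrightarrow> s n < l" unfolding eventually_sequentially by blast
  then have "?I \<subseteq> {..<N}" by (metis (mono_tags) lessThan_iff less_irrefl mem_Collect_eq not_le subsetI)
  then show fin: "finite ?I" by (rule finite_subset) simp
  have norm1: "norm (v n) = 1" if "n \<in> ?I" for n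
    using on v0[of n] that l by (auto simp: orthonormal_or_zero_def)
  have orth: "cinner (v i) (v j) = 0" if "i \<noteq> j" for i j
    using on that by (simp add: orthonormal_or_zero_def)
  have inj: "inj_on v ?I"
  proof (rule inj_onI, rule ccontr)
    fix i j assume "i \<in> ?I" "v i = v j" "i \<noteq> j"
    then have "cinner (v i) (v i) = 0" using orth by metis
    then show False using norm1[OF \<open>i \<in> ?I\<close>] by (simp add: cinner_self)
  qed
  have indep: "V.independent (v ` ?I)"
  proof (rule V.independent_if_scalars_zero)
    fix f x assume sum: "(\<Sum>x\<in>v ` ?I. f x *\<^sub>C x) = 0" and "x \<in> v ` ?I"
    then obtain j where j: "j \<in> ?I" "x = v j" by blast
    have "(\<Sum>i\<in>?I. f (v i) *\<^sub>C v i) = 0" using sum by (simp add: sum.reindex[OF inj])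
    then have "cinner (\<Sum>i\<in>?I. f (v i) *\<^sub>C v i) (v j) = 0" by simp
    then show "f x = 0"
      using orthonormal_or_zero_cinner_sum[OF on fin j(1), of "\<lambda>i. f (v i)"] norm1[OF j(1)] j(2) by simp
  qed (use fin in simp)
  define E where "E = {x. adj T (T x) = l\<^sup>2 *\<^sub>R x}"
  have lin': "adj T (T (c *\<^sub>C x)) = c *\<^sub>C adj T (T x)" for c x
    using T is_clinear_adj[OF T] by (simp add: is_clinear_def)
  have sub: "V.subspace E"
  proof (rule V.subspaceI)
    show "c *\<^sub>C x \<in> E" if "x \<in> E" for c x
      using that by (simp add: E_def lin' scaleR_scaleC scaleC_scaleC mult.commute)
  qed (simp_all add: E_def blinfun.zero_right blinfun.add_right scaleR_add_right)
  have "v ` ?I \<subseteq> E" using eig by (auto simp: E_def)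
  moreover have "E \<subseteq> V.span (v ` ?I)"
  proof
    fix x assume "x \<in> E"
    then have x: "adj T (T x) = l\<^sup>2 *\<^sub>R x" by (simp add: E_def)
    have other: "cinner x (v n) = 0" if "n \<notin> ?I" for n
    proof -
      have "of_real (l\<^sup>2) * cinner x (v n) = cinner (adj T (T x)) (v n)"
        by (simp only: x cinner_scaleR_left)
      also have "\<dots> = cinner x (adj T (T (v n)))"
        by (simp add: cinner_adj'[OF T] cinner_adj[OF T])
      also have "\<dots> = of_real ((s n)\<^sup>2) * cinner x (v n)"
        by (simp only: eig cinner_scaleR_right)
      finally have "(l\<^sup>2 = (s n)\<^sup>2) \<or> cinner x (v n) = 0"
        by (metis mult_right_cancel of_real_eq_iff)
      then show ?thesis using that l s0[of n] by (auto simp: power2_eq_iff_nonneg)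
    qed
    define p where "p = (\<Sum>i\<in>?I. cinner x (v i) *\<^sub>C v i)"
    have p: "p \<in> V.span (v ` ?I)"
      unfolding p_def by (intro V.span_sum V.span_scale V.span_base) auto
    have p_E: "p \<in> E" using p V.span_minimal[OF \<open>v ` ?I \<subseteq> E\<close> sub] by blast
    define r where "r = x - p"
    have "cinner r (v j) = 0" for j
    proof (cases "j \<in> ?I")
      case True
      then show ?thesis unfolding r_def p_def by (rule orthonormal_or_zero_residual[OF on fin])
    next
      case False
      have "cinner p (v j) = (\<Sum>i\<in>?I. 0)"
        unfolding p_def cinner_sum_left
      proof (rule sum.cong)
        fix i assume "i \<in> ?I"
        then have "i \<noteq> j" using False by blast
        then show "cinner (cinner x (v i) *\<^sub>C v i) (v j) = 0" by (simp add: cinner_scaleC_left orth)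
      qed simp
      then show ?thesis using other[OF False] by (simp add: r_def cinner_diff_left)
    qed
    then have "norm (T r) \<le> s n * norm r" for n by (intro tail)
    moreover have "(\<lambda>n. s n * norm r) \<longlonglongrightarrow> 0 * norm r" by (intro tendsto_intros lim)
    ultimately have "norm (T r) \<le> 0" by (intro LIMSEQ_le_const[of "\<lambda>n. s n * norm r"]) auto
    then have "adj T (T r) = 0" by (simp add: blinfun.zero_right)
    moreover have "adj T (T r) = l\<^sup>2 *\<^sub>R r"
      using x p_E by (simp add: r_def E_def blinfun.diff_right scaleR_diff_right)
    ultimately have "r = 0" using l by simp
    then show "x \<in> V.span (v ` ?I)" using p by (simp add: r_def)
  qed
  ultimately have "V.span (v ` ?I) = V.span E"
    by (metis V.span_eq V.span_superset order_trans)
  then have "V.dim E = card (v ` ?I)" using indep by (rule V.dim_eq_card)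
  also have "\<dots> = card ?I" by (rule card_image[OF inj])
  finally show "card ?I = cdim {x. abs_op T x = l *\<^sub>R x}"
    by (simp add: cdim_def E_def abs_op_eigenspace[OF T l])
qed

text \<open>A decreasing nonnegative sequence is determined by its finite multiplicities of positive values:
  at the first difference, the larger of the two values would occur more often on its side.\<close>

lemma decseq_determined_by_multiplicities:
  fixes s t :: "nat \<Rightarrow> real"
  assumes "decseq s" "\<And>n. 0 \<le> s n" "decseq t" "\<And>n. 0 \<le> t n"
    and fin: "\<And>l. 0 < l \<Longrightarrow> finite {n. s n = l} \<and> finite {n. t n = l}"
    and card: "\<And>l. 0 < l \<Longrightarrow> card {n. s n = l} = card {n. t n = l}"
  shows "s = t"
proof (rule ccontr)
  assume "s \<noteq> t"
  then have ex: "\<exists>n. s n \<noteq> t n" by auto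
  define n where "n = (LEAST n. s n \<noteq> t n)"
  have n: "s n \<noteq> t n" using LeastI_ex[OF ex] by (simp add: n_def)
  have before: "s m = t m" if "m < n" for m using not_less_Least[of m] that unfolding n_def by blast
  have contra: False
    if "a n > b n" "decseq b" "0 \<le> b n" "\<And>m. m < n \<Longrightarrow> a m = b m"
      "finite {m. a m = a n}" "card {m. a m = a n} = card {m. b m = a n}"
    for a b :: "nat \<Rightarrow> real"
  proof -
    have "{m. b m = a n} \<subset> {m. a m = a n}"
    proof
      show "{m. b m = a n} \<subseteq> {m. a m = a n}"
      proof
        fix m assume m: "m \<in> {m. b m = a n}"
        then have "\<not> n \<le> m" using that(1) decseqD[OF that(2), of n m] by auto
        then show "m \<in> {m. a m = a n}" using that(4)[of m] m by simp
      qed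
      show "{m. b m = a n} \<noteq> {m. a m = a n}" using that(1) by (metis (mono_tags) less_irrefl mem_Collect_eq)
    qed
    then show False using psubset_card_mono[OF that(5), of "{m. b m = a n}"] that(6) by simp
  qed
  show False
  proof (cases "s n > t n")
    case True
    then have "s n > 0" using assms(4)[of n] by simp
    then show False using contra[of t s] True assms fin card before by metis
  next
    case False
    then have g: "t n > s n" using n by simp
    then have "t n > 0" using assms(2)[of n] by simp
    then show False using contra[of s t] g assms fin card before by metis
  qed
qed

lemma singular_values_eq:
  assumes "is_clinear T" "singular_system T s v"
  shows "singular_values T = s"
  unfolding singular_values_def
proof (rule the_equality)
  have s: "decseq s" "\<And>n. 0 \<le> s n" using assms(2) by (auto simp: singular_system_def)
  note dim = singular_system_eigenspace_dim[OF assms]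
  show "decseq s \<and> (\<forall>n. 0 \<le> s n) \<and> (\<forall>l>0. finite {n. s n = l} \<and>
      card {n. s n = l} = cdim {x. abs_op T x = l *\<^sub>R x})"
    using s dim by blast
  fix t assume t: "decseq t \<and> (\<forall>n. 0 \<le> t n) \<and> (\<forall>l>0. finite {n. t n = l} \<and>
      card {n. t n = l} = cdim {x. abs_op T x = l *\<^sub>R x})"
  show "t = s"
    by (rule decseq_determined_by_multiplicities) (use s t dim in auto)
qed

text \<open>The left vectors are \<open>u\<^sub>n = Tv\<^sub>n/s\<^sub>n\<close>, which is \<open>0\<close> for \<open>s\<^sub>n = 0\<close> by the convention for division by
  zero, in accordance with \<open>v\<^sub>n = 0\<close>. The last conclusion displays every singular value as a matrix
  coefficient that is linear in \<open>T\<close>, which is how sums of operators are estimated.\<close>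

lemma Schmidt_vectors:
  fixes T :: "'a :: separable_hilbert \<Rightarrow>\<^sub>L 'a"
  assumes T: "compact_op T"
  obtains v u where "singular_system T (singular_values T) v" "orthonormal_or_zero u"
    "\<And>n. blinfun_apply T (v n) = singular_values T n *\<^sub>R u n"
    "\<And>n. adj T (u n) = singular_values T n *\<^sub>R v n"
    "\<And>n. norm (u n) = norm (v n)"
    "\<And>n. singular_values T n = Re (cinner (blinfun_apply T (v n)) (u n))"
proof -
  note lin = compact_op_clinear[OF T]
  obtain s v where sys': "singular_system T s v" using singular_system_exists[OF T] by blast
  have s: "singular_values T = s" by (rule singular_values_eq[OF lin sys'])
  have on: "orthonormal_or_zero v" and v0: "\<And>n. v n = 0 \<longleftrightarrow> s n = 0"
    and eig: "\<And>n. adj T (T (v n)) = (s n)\<^sup>2 *\<^sub>R v n"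
    using sys' by (auto simp: singular_system_def)
  define u where "u n = (1 / s n) *\<^sub>R T (v n)" for n
  have Tv: "T (v n) = s n *\<^sub>R u n" for n
    using v0[of n] by (cases "s n = 0") (simp_all add: u_def blinfun.zero_right)
  have adj_u: "adj T (u n) = s n *\<^sub>R v n" for n
    by (simp add: u_def blinfun.scaleR_right eig power2_eq_square)
  have u_inner: "cinner (u i) (u j) = (s j / s i) * cinner (v i) (v j)" for i j
    by (simp add: u_def[of i] cinner_adj[OF lin] adj_u)
  have norm_u: "norm (u n) = norm (v n)" for n
  proof (cases "s n = 0")
    case False
    then have "(norm (u n))\<^sup>2 = (norm (v n))\<^sup>2" by (simp only: norm_sq_eq u_inner) simp
    then show ?thesis by (simp add: power2_eq_iff_nonneg)
  qed (use v0 in \<open>auto simp: u_def\<close>)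
  have on_u: "orthonormal_or_zero u"
    using on by (auto simp: orthonormal_or_zero_def u_inner norm_u)
  have "s n = Re (cinner (T (v n)) (u n))" for n
  proof (cases "s n = 0")
    case False
    then have "norm (u n) = 1" using on v0[of n] by (auto simp: norm_u orthonormal_or_zero_def)
    then show ?thesis by (simp add: Tv cinner_self)
  qed (simp add: Tv)
  then show thesis using that[of v u] sys' on_u Tv adj_u norm_u by (simp add: s)
qed

lemma singular_values_decseq_nonneg:
  fixes T :: "'a :: separable_hilbert \<Rightarrow>\<^sub>L 'a"
  assumes "compact_op T"
  shows "decseq (singular_values T)" "0 \<le> singular_values T n"
proof -
  obtain v where "singular_system T (singular_values T) v" using Schmidt_vectors[OF assms] by metis
  then show "decseq (singular_values T)" "0 \<le> singular_values T n"
    by (auto simp: singular_system_def)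
qed

section \<open>Ky Fan's maximum principle\<close>

text \<open>A total weight \<open>n\<close> with weights at most one is best spent on the first \<open>n\<close> terms. Subtracting the
  constant \<open>s n\<close> makes the terms below \<open>n\<close> nonnegative and all later ones nonpositive.\<close>

lemma sum_weighted_decseq_le:
  fixes s d :: "nat \<Rightarrow> real"
  assumes "decseq s" "\<And>j. 0 \<le> s j" "\<And>j. 0 \<le> d j" "\<And>j. d j \<le> 1"
    and "(\<Sum>j<N. d j) \<le> real n" "n \<le> N"
  shows "(\<Sum>j<N. d j * s j) \<le> (\<Sum>j<n. s j)"
proof -
  have "(\<Sum>j<N. d j * (s j - s n)) \<le> (\<Sum>j<N. if j < n then s j - s n else 0)"
  proof (rule sum_mono)
    fix j
    show "d j * (s j - s n) \<le> (if j < n then s j - s n else 0)"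
      using assms(3,4)[of j] decseqD[OF assms(1), of j n] decseqD[OF assms(1), of n j]
      by (auto simp: mult_le_0_iff mult_left_le_one_le)
  qed
  also have "\<dots> = (\<Sum>j<n. s j - s n)"
    by (subst sum.inter_filter[symmetric]) (use assms(6) in \<open>auto intro!: sum.cong\<close>)
  finally have "(\<Sum>j<N. d j * s j) \<le> (\<Sum>j<n. s j) + s n * ((\<Sum>j<N. d j) - real n)"
    by (simp add: sum_subtractf sum_distrib_left sum_distrib_right algebra_simps)
  also have "s n * ((\<Sum>j<N. d j) - real n) \<le> 0"
    using assms(2,5) by (intro mult_nonneg_nonpos) auto
  finally show ?thesis by simp
qed

text \<open>Expanding \<open>T\<close> in Schmidt vectors gives \<open>2 Re \<langle>Tq\<^sub>k, p\<^sub>k\<rangle> = \<Sum>\<^sub>j s\<^sub>j \<cdot> 2 Re (\<beta>\<^sup>* \<alpha>)\<close> with \<open>\<alpha> = \<langle>u\<^sub>j, p\<^sub>k\<rangle>\<close> and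
  \<open>\<beta> = \<langle>v\<^sub>j, q\<^sub>k\<rangle>\<close>, and \<open>2 Re (\<beta>\<^sup>* \<alpha>) \<le> |\<alpha> + \<beta>|\<^sup>2/2\<close>. The last number is the squared modulus of the inner
  product in \<open>H \<oplus> H\<close> of \<open>(u\<^sub>j, v\<^sub>j)/\<surd>2\<close> and \<open>(p\<^sub>k, q\<^sub>k)\<close>. Since the first
  system is orthonormal up to zero vectors and the second one satisfies Bessel's inequality, these
  numbers form a doubly substochastic matrix.

  Taking the pairs together is what makes the factor \<open>2\<close> possible: the components \<open>p\<close> and \<open>q\<close> taken
  separately would only give the estimate without it.\<close>

lemma Ky_Fan_pairs:
  fixes T :: "'a :: separable_hilbert \<Rightarrow>\<^sub>L 'a"
  assumes T: "compact_op T" and b: "bessel n (\<lambda>k. (p k, q k))"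
  shows "2 * (\<Sum>k<n. Re (cinner (blinfun_apply T (q k)) (p k))) \<le> (\<Sum>j<n. singular_values T j)"
proof -
  define s where "s = singular_values T"
  obtain v u where sys: "singular_system T s v" and on_u: "orthonormal_or_zero u"
    and Tv: "\<And>n. T (v n) = s n *\<^sub>R u n" and "\<And>n. adj T (u n) = s n *\<^sub>R v n"
    and norm_u: "\<And>n. norm (u n) = norm (v n)" and "\<And>n. s n = Re (cinner (T (v n)) (u n))"
    by (rule Schmidt_vectors[OF T, folded s_def]) (rule that)
  have dec: "decseq s" and s0: "\<And>n. 0 \<le> s n" and lim: "s \<longlonglongrightarrow> 0" and on_v: "orthonormal_or_zero v"
    and tail: "\<And>n x. (\<And>k. k < n \<Longrightarrow> cinner x (v k) = 0) \<Longrightarrow> norm (T x) \<le> s n * norm x"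
    using sys by (auto simp: singular_system_def)
  define D where "D k j = (cmod (cinner (u j, v j) (p k, q k)))\<^sup>2 / 2" for k j
  have norm_v: "norm (v j) = 0 \<or> norm (v j) = 1" for j
    using on_v by (auto simp: orthonormal_or_zero_def)
  have norm_pq: "norm (p k, q k) \<le> 1" if "k < n" for k by (rule bessel_norm_le[OF b that])
  have norm_p: "norm (p k) \<le> 1" and norm_q: "norm (q k) \<le> 1" if "k < n" for k
    using norm_pq[OF that] norm_fst_le[of "p k" "q k"] norm_snd_le[of "q k" "p k"] by linarith+
  have col: "(\<Sum>k<n. D k j) \<le> 1" for j
  proof -
    have "(\<Sum>k<n. D k j) \<le> (norm (u j, v j))\<^sup>2 / 2"
      unfolding D_def sum_divide_distrib[symmetric] using besselD[OF b, of "(u j, v j)"] by simp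
    also have "\<dots> \<le> 1" using norm_v[of j] by (auto simp: norm_Pair norm_u)
    finally show ?thesis .
  qed
  have row: "(\<Sum>j<N. D k j) \<le> 1" if k: "k < n" for k N
  proof -
    define w where "w j = (1 / sqrt 2) *\<^sub>R (u j, v j)" for j
    have "norm (w j) \<in> {0, 1}" for j
      using norm_v[of j] by (auto simp: w_def norm_Pair norm_u real_sqrt_divide simp del: scaleR_Pair)
    then have "orthonormal_or_zero w"
      using on_u on_v by (auto simp: orthonormal_or_zero_def w_def simp del: scaleR_Pair)
    then have "(\<Sum>j<N. (cmod (cinner (p k, q k) (w j)))\<^sup>2) \<le> (norm (p k, q k))\<^sup>2"
      by (intro besselD orthonormal_or_zero_bessel)
    also have "\<dots> \<le> 1" using norm_pq[OF k] by (simp add: power_le_one)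
    also have "(\<Sum>j<N. (cmod (cinner (p k, q k) (w j)))\<^sup>2) = (\<Sum>j<N. D k j)"
      unfolding D_def w_def cinner_scaleR_right
      by (intro sum.cong refl, subst cmod_cinner_commute[of "(u _, v _)"])
        (simp add: norm_mult power_mult_distrib norm_divide power_divide del: cinner_Pair)
    finally show ?thesis .
  qed
  have entry: "2 * Re (cinner (q k) (v j) * cinner (u j) (p k)) \<le> D k j" for k j
  proof -
    define a where "a = cinner (u j) (p k)"
    define b where "b = cinner (v j) (q k)"
    have "cinner (q k) (v j) = cnj b" unfolding b_def by (rule cinner_commute)
    moreover have "2 * Re (cnj b * a) \<le> (cmod (a + b))\<^sup>2 / 2"
    proof -
      have "0 \<le> (Re a - Re b)\<^sup>2 + (Im a - Im b)\<^sup>2" by simp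
      then show ?thesis unfolding cmod_power2 by (simp add: power2_eq_square algebra_simps)
    qed
    ultimately show ?thesis by (simp add: D_def a_def b_def)
  qed
  \<comment> \<open>The expansion is used up to a finite index \<open>N\<close>; each of the \<open>n\<close> remainders is at most \<open>s N\<close>.\<close>
  have approx: "2 * (\<Sum>k<n. Re (cinner (T (q k)) (p k))) \<le> (\<Sum>j<n. s j) + 2 * real n * s N" if N: "n \<le> N" for N
  proof -
    have each: "2 * Re (cinner (T (q k)) (p k)) \<le> (\<Sum>j<N. D k j * s j) + 2 * s N" if k: "k < n" for k
    proof -
      define c where "c j = cinner (q k) (v j)" for j
      define r where "r = q k - (\<Sum>j<N. c j *\<^sub>C v j)"
      have lin: "T (c *\<^sub>C x) = c *\<^sub>C T x" for c x
        using compact_op_clinear[OF T] by (simp add: is_clinear_def)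
      have "norm r \<le> norm (q k)"
      proof (rule power2_le_imp_le)
        show "(norm r)\<^sup>2 \<le> (norm (q k))\<^sup>2"
          unfolding r_def c_def norm_residual_sq[OF on_v finite_lessThan]
          by (simp add: sum_nonneg)
      qed simp
      then have norm_r: "norm r \<le> 1" using norm_q[OF k] by linarith
      have "norm (T r) \<le> s N * norm r"
        by (rule tail) (simp add: r_def c_def orthonormal_or_zero_residual[OF on_v])
      also have "\<dots> \<le> s N * 1" by (intro mult_left_mono norm_r s0)
      finally have Tr: "norm (T r) \<le> s N" by simp
      have "Re (cinner (T r) (p k)) \<le> norm (T r) * norm (p k)" by (rule Re_cinner_le)
      also have "\<dots> \<le> s N * 1" using Tr norm_p[OF k] s0 by (intro mult_mono) auto
      finally have rest: "Re (cinner (T r) (p k)) \<le> s N" by simp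
      have "T (q k) = T ((\<Sum>j<N. c j *\<^sub>C v j) + r)" by (simp add: r_def)
      also have "\<dots> = (\<Sum>j<N. s j *\<^sub>R (c j *\<^sub>C u j)) + T r"
        by (simp add: blinfun.add_right blinfun.sum_right lin Tv scaleR_scaleC scaleC_scaleC mult.commute)
      finally have "2 * Re (cinner (T (q k)) (p k))
          = (\<Sum>j<N. s j * (2 * Re (c j * cinner (u j) (p k)))) + 2 * Re (cinner (T r) (p k))"
        by (simp add: cinner_add_left cinner_sum_left cinner_scaleC_left sum_distrib_left
            right_diff_distrib mult_ac)
      also have "\<dots> \<le> (\<Sum>j<N. s j * D k j) + 2 * s N"
        using rest unfolding c_def by (intro add_mono sum_mono mult_left_mono entry s0) auto
      finally show ?thesis by (simp add: mult.commute)
    qed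
    have "2 * (\<Sum>k<n. Re (cinner (T (q k)) (p k))) \<le> (\<Sum>k<n. (\<Sum>j<N. D k j * s j) + 2 * s N)"
      unfolding sum_distrib_left by (intro sum_mono each) simp
    also have "\<dots> = (\<Sum>j<N. (\<Sum>k<n. D k j) * s j) + 2 * real n * s N"
      unfolding sum.distrib sum_distrib_right by (subst sum.swap) simp
    also have "(\<Sum>j<N. (\<Sum>k<n. D k j) * s j) \<le> (\<Sum>j<n. s j)"
    proof (rule sum_weighted_decseq_le[OF dec s0 _ col _ N])
      show "0 \<le> (\<Sum>k<n. D k j)" for j by (simp add: D_def sum_nonneg)
      have "(\<Sum>j<N. \<Sum>k<n. D k j) = (\<Sum>k<n. \<Sum>j<N. D k j)" by (rule sum.swap)
      also have "\<dots> \<le> (\<Sum>k<n. 1)" by (intro sum_mono row) simp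
      finally show "(\<Sum>j<N. \<Sum>k<n. D k j) \<le> real n" by simp
    qed
    finally show ?thesis by simp
  qed
  have "(\<lambda>N. (\<Sum>j<n. s j) + 2 * real n * s N) \<longlonglongrightarrow> (\<Sum>j<n. s j) + 2 * real n * 0"
    by (intro tendsto_intros lim)
  then have "2 * (\<Sum>k<n. Re (cinner (T (q k)) (p k))) \<le> (\<Sum>j<n. s j) + 2 * real n * 0"
    by (rule LIMSEQ_le_const) (use approx in blast)
  then show ?thesis by (simp add: s_def)
qed

section \<open>Triangle inequality and ideal property of the norm\<close>

text \<open>Pairs scaled by \<open>1/\<surd>2\<close> reduce the usual form of Ky Fan's principle, with two independent systems, to the
  one for pairs; the two factors \<open>1/\<surd>2\<close> cancel the factor \<open>2\<close> there.\<close>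

lemma bessel_Pair:
  fixes e :: "nat \<Rightarrow> 'a :: complex_inner" and f :: "nat \<Rightarrow> 'b :: complex_inner"
  assumes "bessel n e" "bessel n f"
  shows "bessel n (\<lambda>k. ((1 / sqrt 2) *\<^sub>R f k, (1 / sqrt 2) *\<^sub>R e k))"
  unfolding bessel_def
proof
  fix x :: "'b \<times> 'a"
  obtain z w where x: "x = (z, w)" by (cases x)
  have "(cmod (cinner x ((1 / sqrt 2) *\<^sub>R f k, (1 / sqrt 2) *\<^sub>R e k)))\<^sup>2
      \<le> (cmod (cinner z (f k)))\<^sup>2 + (cmod (cinner w (e k)))\<^sup>2" for k
  proof -
    define a b where "a = cinner z (f k)" and "b = cinner w (e k)"
    have "(cmod (cinner x ((1 / sqrt 2) *\<^sub>R f k, (1 / sqrt 2) *\<^sub>R e k)))\<^sup>2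
        = (cmod ((1 / sqrt 2) *\<^sub>R (a + b)))\<^sup>2"
      by (simp add: x a_def b_def scaleR_conv_of_real algebra_simps)
    also have "\<dots> = (cmod (a + b))\<^sup>2 / 2" by (simp add: power_divide)
    also have "\<dots> \<le> (cmod a)\<^sup>2 + (cmod b)\<^sup>2"
    proof -
      have "0 \<le> (Re a - Re b)\<^sup>2 + (Im a - Im b)\<^sup>2" by simp
      then show ?thesis unfolding cmod_power2 by (simp add: power2_eq_square algebra_simps)
    qed
    finally show ?thesis by (simp add: a_def b_def)
  qed
  then have "(\<Sum>k<n. (cmod (cinner x ((1 / sqrt 2) *\<^sub>R f k, (1 / sqrt 2) *\<^sub>R e k)))\<^sup>2)
      \<le> (\<Sum>k<n. (cmod (cinner z (f k)))\<^sup>2) + (\<Sum>k<n. (cmod (cinner w (e k)))\<^sup>2)"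
    unfolding sum.distrib[symmetric] by (rule sum_mono)
  also have "\<dots> \<le> (norm z)\<^sup>2 + (norm w)\<^sup>2" using assms by (intro add_mono besselD)
  also have "\<dots> = (norm x)\<^sup>2" by (simp add: x norm_Pair)
  finally show "(\<Sum>k<n. (cmod (cinner x ((1 / sqrt 2) *\<^sub>R f k, (1 / sqrt 2) *\<^sub>R e k)))\<^sup>2) \<le> (norm x)\<^sup>2" .
qed

lemma Ky_Fan_upper:
  fixes T :: "'a :: separable_hilbert \<Rightarrow>\<^sub>L 'a"
  assumes "compact_op T" "bessel n e" "bessel n f"
  shows "(\<Sum>k<n. Re (cinner (blinfun_apply T (e k)) (f k))) \<le> (\<Sum>j<n. singular_values T j)"
proof -
  have half: "2 * Re (cinner (T ((1 / sqrt 2) *\<^sub>R e k)) ((1 / sqrt 2) *\<^sub>R f k)) = Re (cinner (T (e k)) (f k))" for k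
    by (simp add: blinfun.scaleR_right)
  have "2 * (\<Sum>k<n. Re (cinner (T ((1 / sqrt 2) *\<^sub>R e k)) ((1 / sqrt 2) *\<^sub>R f k)))
      = (\<Sum>k<n. Re (cinner (T (e k)) (f k)))"
    unfolding sum_distrib_left half ..
  then show ?thesis
    using Ky_Fan_pairs[OF assms(1) bessel_Pair[OF assms(2,3)]] by (simp only:)
qed

lemma compact_opI:
  assumes "is_clinear T" "compact K" "\<And>x. norm x \<le> 1 \<Longrightarrow> blinfun_apply T x \<in> K"
  shows "compact_op T"
proof -
  have "blinfun_apply T ` cball 0 1 \<subseteq> K" using assms(3) by auto
  then have "closure (blinfun_apply T ` cball 0 1) \<subseteq> K"
    using compact_imp_closed[OF assms(2)] by (rule closure_minimal)
  then have "compact (closure (blinfun_apply T ` cball 0 1))"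
    using compact_Int_closed[OF assms(2) closed_closure] by (metis Int_absorb1)
  then show ?thesis using assms(1) by (simp add: compact_op_def)
qed

lemma compact_op_in:
  assumes "compact_op T"
  obtains K where "compact K" "\<And>x. norm x \<le> 1 \<Longrightarrow> blinfun_apply T x \<in> K"
proof
  show "compact (closure (blinfun_apply T ` cball 0 1))" using assms by (simp add: compact_op_def)
  show "blinfun_apply T x \<in> closure (blinfun_apply T ` cball 0 1)" if "norm x \<le> 1" for x
    by (rule subsetD[OF closure_subset]) (use that in auto)
qed

lemma compact_op_add:
  assumes "compact_op T" "compact_op S"
  shows "compact_op (T + S)"
proof -
  obtain K where K: "compact K" "\<And>x. norm x \<le> 1 \<Longrightarrow> T x \<in> K" by (rule compact_op_in[OF assms(1)]) (rule that)
  obtain L where L: "compact L" "\<And>x. norm x \<le> 1 \<Longrightarrow> S x \<in> L" by (rule compact_op_in[OF assms(2)]) (rule that)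
  show ?thesis
  proof (rule compact_opI)
    show "is_clinear (T + S)"
      using assms by (simp add: compact_op_def is_clinear_def blinfun.add_left scaleC_add_right)
    show "compact {x + y |x y. x \<in> K \<and> y \<in> L}" by (rule compact_sums[OF K(1) L(1)])
    show "(T + S) x \<in> {x + y |x y. x \<in> K \<and> y \<in> L}" if "norm x \<le> 1" for x
      using K(2)[OF that] L(2)[OF that] by (auto simp: blinfun.add_left)
  qed
qed

lemma compact_op_compose_left:
  assumes "compact_op T" "is_clinear C"
  shows "compact_op (C o\<^sub>L T)"
proof -
  obtain K where K: "compact K" "\<And>x. norm x \<le> 1 \<Longrightarrow> T x \<in> K" by (rule compact_op_in[OF assms(1)]) (rule that)
  show ?thesis
  proof (rule compact_opI)
    show "is_clinear (C o\<^sub>L T)" using assms by (simp add: compact_op_def is_clinear_def)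
    show "compact (blinfun_apply C ` K)"
      by (intro compact_continuous_image K linear_continuous_on blinfun.bounded_linear_right)
  qed (use K(2) in auto)
qed

lemma compact_op_compose_right:
  assumes "compact_op T" "is_clinear C"
  shows "compact_op (T o\<^sub>L C)"
proof -
  obtain K where K: "compact K" "\<And>x. norm x \<le> 1 \<Longrightarrow> T x \<in> K" by (rule compact_op_in[OF assms(1)]) (rule that)
  define c where "c = norm C + 1"
  have c: "c > 0" by (simp add: c_def add_nonneg_pos)
  show ?thesis
  proof (rule compact_opI)
    show "is_clinear (T o\<^sub>L C)" using assms by (simp add: compact_op_def is_clinear_def)
    show "compact ((*\<^sub>R) c ` K)" by (rule compact_scaling[OF K(1)])
    fix x :: 'a assume x: "norm x \<le> 1"
    have "norm (C x) \<le> norm C * norm x" by (rule norm_blinfun)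
    also have "\<dots> \<le> norm C * 1" by (intro mult_left_mono x) simp
    finally have "norm ((1 / c) *\<^sub>R C x) \<le> 1" using c by (simp add: c_def field_simps)
    then have "T ((1 / c) *\<^sub>R C x) \<in> K" by (rule K(2))
    then show "(T o\<^sub>L C) x \<in> (*\<^sub>R) c ` K"
      by (rule rev_image_eqI) (use c in \<open>simp add: blinfun.scaleR_right\<close>)
  qed
qed

lemma is_clinear_scaleR: "is_clinear T \<Longrightarrow> is_clinear (r *\<^sub>R T)"
  by (simp add: is_clinear_def blinfun.scaleR_left scaleR_scaleC scaleC_scaleC mult.commute)

lemma is_clinear_id: "is_clinear id_blinfun"
  by (simp add: is_clinear_def)

lemma compact_op_uminus:
  assumes "compact_op T"
  shows "compact_op (- T)"
proof -
  have "- T = ((-1) *\<^sub>R id_blinfun) o\<^sub>L T"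
    by (rule blinfun_eqI) (simp add: blinfun.minus_left blinfun.scaleR_left)
  then show ?thesis
    using compact_op_compose_left[OF assms is_clinear_scaleR[OF is_clinear_id, of "-1"]] by simp
qed

lemma compact_op_diff: "compact_op T \<Longrightarrow> compact_op S \<Longrightarrow> compact_op (T - S)"
  using compact_op_add[of T "- S"] compact_op_uminus[of S] by simp

context
  fixes g :: "(nat \<Rightarrow> real) \<Rightarrow> real"
  assumes g: "symmetric_gauge g"
begin

text \<open>All norm estimates below are instances: it remains to write the singular values of the operator as
  matrix coefficients and to bound their partial sums by Ky Fan's principle.\<close>

lemma ui_norm_dominated:
  fixes T :: "'a :: separable_hilbert \<Rightarrow>\<^sub>L 'a"
  assumes "compact_op T" "\<And>i. 0 \<le> y i" "\<And>r. (\<Sum>i<r. singular_values T i) \<le> (\<Sum>i<r. y i)"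
  shows "ui_norm g T \<le> gauge_ext g y"
  unfolding ui_norm_def using assms
  by (intro Fan_dominance[OF g] singular_values_decseq_nonneg)

lemma ui_norm_nonneg: "0 \<le> ui_norm g T"
  by (simp add: ui_norm_def gauge_ext_nonneg[OF g])

lemma ui_norm_triangle:
  fixes T S :: "'a :: separable_hilbert \<Rightarrow>\<^sub>L 'a"
  assumes T: "compact_op T" and S: "compact_op S"
  shows "ui_norm g (T + S) \<le> ui_norm g T + ui_norm g S"
proof -
  note TS = compact_op_add[OF T S]
  obtain v u where sys: "singular_system (T + S) (singular_values (T + S)) v" and u: "orthonormal_or_zero u"
    and eq: "\<And>n. singular_values (T + S) n = Re (cinner ((T + S) (v n)) (u n))"
    by (rule Schmidt_vectors[OF TS]) blast
  have v: "orthonormal_or_zero v" using sys by (simp add: singular_system_def)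
  have "ui_norm g (T + S) \<le> gauge_ext g (\<lambda>i. singular_values T i + singular_values S i)"
  proof (rule ui_norm_dominated[OF TS])
    show "0 \<le> singular_values T i + singular_values S i" for i
      by (intro add_nonneg_nonneg singular_values_decseq_nonneg T S)
    fix r
    have "(\<Sum>i<r. singular_values (T + S) i)
        = (\<Sum>i<r. Re (cinner (T (v i)) (u i))) + (\<Sum>i<r. Re (cinner (S (v i)) (u i)))"
      unfolding eq by (simp add: blinfun.add_left cinner_add_left sum.distrib)
    also have "\<dots> \<le> (\<Sum>i<r. singular_values T i) + (\<Sum>i<r. singular_values S i)"
      by (intro add_mono Ky_Fan_upper T S orthonormal_or_zero_bessel u v)
    finally show "(\<Sum>i<r. singular_values (T + S) i) \<le> (\<Sum>i<r. singular_values T i + singular_values S i)"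
      by (simp add: sum.distrib)
  qed
  also have "\<dots> \<le> ui_norm g T + ui_norm g S"
    unfolding ui_norm_def by (rule gauge_ext_add_le[OF g])
  finally show ?thesis .
qed

lemma bessel_contraction:
  fixes C :: "'a :: separable_hilbert \<Rightarrow>\<^sub>L 'a"
  assumes "is_clinear C" "norm C \<le> c" "0 < c" "bessel n e"
  shows "bessel n (\<lambda>k. (1 / c) *\<^sub>R blinfun_apply C (e k))"
  unfolding bessel_def
proof
  fix x
  define y where "y = (1 / c) *\<^sub>R adj C x"
  have "cinner x ((1 / c) *\<^sub>R C (e k)) = cinner y (e k)" for k
    by (simp add: y_def cinner_adj'[OF assms(1)])
  then have "(\<Sum>k<n. (cmod (cinner x ((1 / c) *\<^sub>R C (e k))))\<^sup>2) \<le> (norm y)\<^sup>2"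
    using besselD[OF assms(4), of y] by simp
  also have "norm y \<le> norm x"
  proof -
    have "norm (adj C x) \<le> norm (adj C) * norm x" by (rule norm_blinfun)
    also have "\<dots> \<le> c * norm x"
      using norm_adj_le[OF assms(1)] assms(2) by (intro mult_right_mono) auto
    finally show ?thesis using assms(3) by (simp add: y_def field_simps)
  qed
  then have "(norm y)\<^sup>2 \<le> (norm x)\<^sup>2" by (intro power_mono) auto
  finally show "(\<Sum>k<n. (cmod (cinner x ((1 / c) *\<^sub>R C (e k))))\<^sup>2) \<le> (norm x)\<^sup>2" .
qed

text \<open>The singular values of \<open>CXD\<close> are \<open>\<langle>X Dv\<^sub>k, C\<^sup>*u\<^sub>k\<rangle>\<close>, and the systems \<open>Dv\<^sub>k/d\<close> and \<open>C\<^sup>*u\<^sub>k/c\<close> still satisfy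
  Bessel's inequality.\<close>

lemma ui_norm_ideal:
  fixes X C D :: "'a :: separable_hilbert \<Rightarrow>\<^sub>L 'a"
  assumes X: "compact_op X" and C: "is_clinear C" "norm C \<le> c" "0 < c"
    and D: "is_clinear D" "norm D \<le> d" "0 < d"
  shows "ui_norm g (C o\<^sub>L X o\<^sub>L D) \<le> ereal (c * d) * ui_norm g X"
proof -
  define W where "W = C o\<^sub>L X o\<^sub>L D"
  have W: "compact_op W"
    unfolding W_def by (intro compact_op_compose_right compact_op_compose_left X C D)
  obtain v u where sys: "singular_system W (singular_values W) v" and u: "orthonormal_or_zero u"
    and eq: "\<And>n. singular_values W n = Re (cinner (W (v n)) (u n))"
    by (rule Schmidt_vectors[OF W]) blast
  have v: "orthonormal_or_zero v" using sys by (simp add: singular_system_def)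
  have adj_C: "is_clinear (adj C)" "norm (adj C) \<le> c"
    using is_clinear_adj[OF C(1)] norm_adj_le[OF C(1)] C(2) by auto
  have "ui_norm g W \<le> gauge_ext g (\<lambda>i. (c * d) * singular_values X i)"
  proof (rule ui_norm_dominated[OF W])
    show "0 \<le> (c * d) * singular_values X i" for i
      using singular_values_decseq_nonneg(2)[OF X] C D by simp
    fix r
    have "(\<Sum>i<r. singular_values W i)
        = c * d * (\<Sum>i<r. Re (cinner (X ((1 / d) *\<^sub>R D (v i))) ((1 / c) *\<^sub>R adj C (u i))))"
      unfolding eq sum_distrib_left using C(3) D(3)
      by (intro sum.cong refl) (simp add: W_def blinfun.scaleR_right cinner_adj[OF C(1)])
    also have "\<dots> \<le> c * d * (\<Sum>i<r. singular_values X i)"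
      using C D by (intro mult_left_mono Ky_Fan_upper X bessel_contraction
          orthonormal_or_zero_bessel u v adj_C) auto
    finally show "(\<Sum>i<r. singular_values W i) \<le> (\<Sum>i<r. (c * d) * singular_values X i)"
      by (simp add: sum_distrib_left)
  qed
  also have "\<dots> = ereal (c * d) * ui_norm g X"
    unfolding ui_norm_def using C D by (intro gauge_ext_scale[OF g]) simp
  finally show ?thesis by (simp add: W_def)
qed

lemma ui_norm_uminus_le:
  fixes T :: "'a :: separable_hilbert \<Rightarrow>\<^sub>L 'a"
  assumes "compact_op T"
  shows "ui_norm g (- T) \<le> ui_norm g T"
proof -
  have "ui_norm g (((-1) *\<^sub>R id_blinfun) o\<^sub>L T o\<^sub>L id_blinfun) \<le> ereal (1 * 1) * ui_norm g T"
    by (intro ui_norm_ideal assms is_clinear_scaleR is_clinear_id) (simp_all add: norm_blinfun_id_le)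
  moreover have "((-1) *\<^sub>R id_blinfun) o\<^sub>L T o\<^sub>L id_blinfun = - T"
    by (rule blinfun_eqI) (simp add: blinfun.minus_left blinfun.scaleR_left)
  ultimately show ?thesis by simp
qed

lemma ui_norm_uminus:
  fixes T :: "'a :: separable_hilbert \<Rightarrow>\<^sub>L 'a"
  assumes "compact_op T"
  shows "ui_norm g (- T) = ui_norm g T"
  using ui_norm_uminus_le[OF assms] ui_norm_uminus_le[OF compact_op_uminus[OF assms]]
  by (simp add: antisym)

lemma ui_norm_zero: "ui_norm g (0 :: 'a :: separable_hilbert \<Rightarrow>\<^sub>L 'a) = 0"
proof -
  have c: "compact_op (0 :: 'a \<Rightarrow>\<^sub>L 'a)"
    by (rule compact_opI[of _ "{0}"]) (simp_all add: is_clinear_def)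
  obtain v u where eq: "\<And>n. singular_values (0 :: 'a \<Rightarrow>\<^sub>L 'a) n = Re (cinner ((0 :: 'a \<Rightarrow>\<^sub>L 'a) (v n)) (u n))"
    by (rule Schmidt_vectors[OF c]) blast
  then have "singular_values (0 :: 'a \<Rightarrow>\<^sub>L 'a) = (\<lambda>n. 0)" by (intro ext) simp
  then show ?thesis by (simp add: ui_norm_def gauge_ext_zero[OF g])
qed

end

section \<open>The arithmetic-geometric mean inequality\<close>

text \<open>Gram-Schmidt orthonormalisation of eigenvectors. The spans of the first \<open>k\<close> eigenvectors are
  invariant, so in the new basis \<open>M\<close> is triangular, and since each residual differs from its eigenvector
  by an element of the previous span, the diagonal entries are the eigenvalues.\<close>

lemma triangularizing_orthonormal_basis:
  fixes M :: "'b :: complex_inner \<Rightarrow> 'b" and w :: "nat \<Rightarrow> 'b" and s :: "nat \<Rightarrow> real"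
  assumes add: "\<And>x y. M (x + y) = M x + M y" and scale: "\<And>c x. M (c *\<^sub>C x) = c *\<^sub>C M x"
    and eig: "\<And>k. k < n \<Longrightarrow> M (w k) = s k *\<^sub>R w k"
    and indep: "\<And>k. k < n \<Longrightarrow> w k \<notin> module.span scaleC (w ` {..<k})"
  shows "\<exists>e. orthonormal_or_zero e \<and> (\<forall>k<n. Re (cinner (M (e k)) (e k)) = s k)"
proof -
  interpret V: vector_space "scaleC :: complex \<Rightarrow> 'b \<Rightarrow> 'b" by (rule vector_space_scaleC)
  have M0: "M 0 = 0" using scale[of 0 0] by simp
  have M_span: "x \<in> V.span (w ` {..<m}) \<Longrightarrow> M x \<in> V.span (w ` {..<m})" if "m \<le> n" for x m
  proof (induction rule: V.span_induct_alt)
    case (step c x y)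
    then obtain k where k: "k < m" "x = w k" by blast
    then have "M (c *\<^sub>C x + y) = (c * s k) *\<^sub>C w k + M y"
      using eig[of k] that by (simp add: add scale scaleR_scaleC scaleC_scaleC)
    moreover have "(c * s k) *\<^sub>C w k + M y \<in> V.span (w ` {..<m})"
      using k step by (intro V.span_add[OF V.span_scale[OF V.span_base]]) auto
    ultimately show ?case using k by simp
  qed (simp add: M0 V.span_zero)
  have "m \<le> n \<Longrightarrow> \<exists>e. orthonormal_or_zero e \<and> (\<forall>k\<ge>m. e k = 0) \<and>
      V.span (e ` {..<m}) = V.span (w ` {..<m}) \<and> (\<forall>k<m. Re (cinner (M (e k)) (e k)) = s k)" for m
  proof (induction m)
    case 0
    show ?case by (intro exI[of _ "\<lambda>_. 0"]) (simp add: orthonormal_or_zero_def)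
  next
    case (Suc m)
    then obtain e where e: "orthonormal_or_zero e" "\<And>k. k \<ge> m \<Longrightarrow> e k = 0"
      "V.span (e ` {..<m}) = V.span (w ` {..<m})" "\<And>k. k < m \<Longrightarrow> Re (cinner (M (e k)) (e k)) = s k"
      by auto
    define c where "c k = cinner (w m) (e k)" for k
    define p where "p = (\<Sum>k<m. c k *\<^sub>C e k)"
    define r where "r = w m - p"
    have p: "p \<in> V.span (w ` {..<m})"
      unfolding p_def e(3)[symmetric] by (intro V.span_sum V.span_scale V.span_base) auto
    have r0: "r \<noteq> 0" using indep[of m] p Suc.prems by (auto simp: r_def)
    have r_orth: "cinner r (e k) = 0" for k
    proof (cases "k < m")
      case True
      then show ?thesis
        unfolding r_def p_def c_def by (intro orthonormal_or_zero_residual[OF e(1)]) auto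
    qed (simp add: e(2))
    have r_span: "cinner x r = 0" if "x \<in> V.span (w ` {..<m})" for x
      using that unfolding e(3)[symmetric]
    proof (induction rule: V.span_induct_alt)
      case (step a x y)
      then have "cinner x r = 0" using r_orth cinner_commute[of x r] by auto
      then show ?case using step by (simp add: cinner_simps)
    qed simp
    define h where "h = (1 / norm r) *\<^sub>R r"
    have h: "norm h = 1" "\<And>k. cinner h (e k) = 0" "\<And>k. cinner (e k) h = 0"
      using r0 r_orth cinner_commute[of "e _" r] by (auto simp: h_def)
    define e' where "e' = e(m := h)"
    have on': "orthonormal_or_zero e'"
      using e(1) h by (auto simp: orthonormal_or_zero_def e'_def)
    have w_m: "w m = norm r *\<^sub>R h + p" using r0 by (simp add: h_def r_def)
    have Mr: "M r = s m *\<^sub>R r + (s m *\<^sub>R p - M p)"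
    proof -
      have "M (w m) = M r + M p" unfolding add[symmetric] by (simp add: r_def)
      then have "M r = M (w m) - M p" by simp
      then show ?thesis using eig[of m] Suc.prems by (simp add: r_def scaleR_diff_right)
    qed
    have "s m *\<^sub>R p - M p \<in> V.span (w ` {..<m})"
      using p M_span[of m p] Suc.prems by (auto simp: scaleR_scaleC intro!: V.span_diff V.span_scale)
    then have "cinner (M r) r = s m * (norm r)\<^sup>2"
      unfolding Mr by (simp add: cinner_add_left r_span cinner_self)
    moreover have "M h = (1 / norm r) *\<^sub>R M r"
      by (simp add: h_def scaleR_scaleC scale)
    ultimately have "Re (cinner (M h) h) = s m"
      using r0 by (simp add: h_def power2_eq_square)
    then have val: "\<forall>k<Suc m. Re (cinner (M (e' k)) (e' k)) = s k"
      using e(4) by (auto simp: e'_def less_Suc_eq)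
    have img: "e' ` {..<Suc m} = insert h (e ` {..<m})" by (auto simp: e'_def lessThan_Suc)
    have "V.span (e' ` {..<Suc m}) = V.span (w ` {..<Suc m})"
    proof
      have mono: "V.span (w ` {..<m}) \<subseteq> V.span (w ` {..<Suc m})" by (intro V.span_mono image_mono) auto
      then have "p \<in> V.span (w ` {..<Suc m})" using p by blast
      then have "r \<in> V.span (w ` {..<Suc m})" unfolding r_def by (intro V.span_diff[OF V.span_base]) auto
      then have "h \<in> V.span (w ` {..<Suc m})" unfolding h_def scaleR_scaleC by (rule V.span_scale)
      moreover have "e ` {..<m} \<subseteq> V.span (w ` {..<Suc m})"
        using V.span_superset[of "e ` {..<m}"] mono e(3) by blast
      ultimately show "V.span (e' ` {..<Suc m}) \<subseteq> V.span (w ` {..<Suc m})"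
        unfolding img by (intro V.span_minimal) auto
      have old: "V.span (w ` {..<m}) \<subseteq> V.span (e' ` {..<Suc m})"
        unfolding e(3)[symmetric] img by (intro V.span_mono) auto
      moreover have "w m \<in> V.span (e' ` {..<Suc m})"
        unfolding w_m scaleR_scaleC using p old
        by (intro V.span_add[OF V.span_scale[OF V.span_base]]) (auto simp: img)
      ultimately show "V.span (w ` {..<Suc m}) \<subseteq> V.span (e' ` {..<Suc m})"
        using V.span_superset[of "w ` {..<m}"] by (intro V.span_minimal) (auto simp: lessThan_Suc)
    qed
    moreover have "\<forall>k\<ge>Suc m. e' k = 0" using e(2) by (simp add: e'_def)
    ultimately show ?case using on' val by blast
  qed
  from this[of n] show ?thesis by auto
qed

text \<open>The vectors \<open>w\<^sub>k = (au\<^sub>k, bv\<^sub>k)\<close> are eigenvectors of \<open>M\<close> because \<open>aYbv\<^sub>k = s\<^sub>ku\<^sub>k\<close> and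
  \<open>bY\<^sup>*au\<^sub>k = s\<^sub>kv\<^sub>k\<close>. They are independent as long as \<open>s\<^sub>k > 0\<close>, for the map \<open>(p, q) \<mapsto> bY\<^sup>*p\<close> sends them
  to the orthogonal vectors \<open>s\<^sub>kv\<^sub>k\<close>. Terms with \<open>s\<^sub>k = 0\<close> only occur at the end of the sequence and do not
  contribute to the left-hand side.\<close>

lemma arithmetic_geometric_mean_partial_sums:
  fixes a b Y :: "'a :: separable_hilbert \<Rightarrow>\<^sub>L 'a"
  assumes a: "selfadjoint a" "is_clinear a" and b: "selfadjoint b" "is_clinear b" and Y: "compact_op Y"
  shows "2 * (\<Sum>k<n. singular_values (a o\<^sub>L Y o\<^sub>L b) k)
    \<le> (\<Sum>k<n. singular_values ((a o\<^sub>L a o\<^sub>L Y) + (Y o\<^sub>L b o\<^sub>L b)) k)"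
proof -
  define Z where "Z = a o\<^sub>L Y o\<^sub>L b"
  define T where "T = (a o\<^sub>L a o\<^sub>L Y) + (Y o\<^sub>L b o\<^sub>L b)"
  have Z: "compact_op Z" unfolding Z_def by (intro compact_op_compose_right compact_op_compose_left a b Y)
  have T: "compact_op T"
    unfolding T_def
    by (intro compact_op_add compact_op_compose_right compact_op_compose_left is_clinear_compose a b Y)
  define s where "s = singular_values Z"
  have s: "decseq s" "\<And>k. 0 \<le> s k" unfolding s_def by (rule singular_values_decseq_nonneg[OF Z])+
  have pos_case: "2 * (\<Sum>k<n. s k) \<le> (\<Sum>k<n. singular_values T k)" if pos: "\<And>k. k < n \<Longrightarrow> 0 < s k" for n
  proof -
    obtain v u where sys: "singular_system Z s v" and on_u: "orthonormal_or_zero u"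
      and Zv: "\<And>n. Z (v n) = s n *\<^sub>R u n" and adj_Zu: "\<And>n. adj Z (u n) = s n *\<^sub>R v n"
      and "\<And>n. norm (u n) = norm (v n)" and "\<And>n. s n = Re (cinner (Z (v n)) (u n))"
      by (rule Schmidt_vectors[OF Z, folded s_def]) (rule that)
    have on_v: "orthonormal_or_zero v" and v0: "\<And>k. v k = 0 \<longleftrightarrow> s k = 0"
      using sys by (auto simp: singular_system_def)
    note lin_Y = compact_op_clinear[OF Y]
    have lin: "a (c *\<^sub>C x) = c *\<^sub>C a x" "b (c *\<^sub>C x) = c *\<^sub>C b x" "Y (c *\<^sub>C x) = c *\<^sub>C Y x"
      "adj Y (c *\<^sub>C x) = c *\<^sub>C adj Y x" for c x
      using a(2) b(2) lin_Y is_clinear_adj[OF lin_Y] by (simp_all add: is_clinear_def)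
    have "adj Z = b o\<^sub>L adj Y o\<^sub>L a"
      by (rule adj_unique)
        (simp add: Z_def selfadjointD[OF a(1)] selfadjointD[OF b(1)] cinner_adj[OF lin_Y])
    then have bYa: "b (adj Y (a (u k))) = s k *\<^sub>R v k" for k
      using adj_Zu[of k] by simp
    have aYb: "a (Y (b (v k))) = s k *\<^sub>R u k" for k
      using Zv[of k] by (simp add: Z_def)
    define w where "w k = (a (u k), b (v k))" for k
    define M where "M x = (a (a (Y (snd x))), b (b (adj Y (fst x))))" for x
    have "\<exists>e. orthonormal_or_zero e \<and> (\<forall>k<n. Re (cinner (M (e k)) (e k)) = s k)"
    proof (rule triangularizing_orthonormal_basis)
      show "M (x + y) = M x + M y" for x y
        by (simp add: M_def blinfun.add_right)
      show "M (c *\<^sub>C x) = c *\<^sub>C M x" for c x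
        by (simp add: M_def scaleC_prod_def lin)
      show "M (w k) = s k *\<^sub>R w k" for k
        by (simp add: M_def w_def aYb bYa blinfun.scaleR_right)
      fix k assume k: "k < n"
      interpret V: vector_space "scaleC :: complex \<Rightarrow> 'a \<times> 'a \<Rightarrow> 'a \<times> 'a" by (rule vector_space_scaleC)
      define S :: "('a \<times> 'a) set" where "S = {x. cinner (b (adj Y (fst x))) (v k) = 0}"
      have "V.subspace S"
        by (rule V.subspaceI)
          (auto simp: S_def blinfun.zero_right blinfun.add_right cinner_simps scaleC_prod_def lin)
      moreover have "w ` {..<k} \<subseteq> S"
        using on_v by (auto simp: S_def w_def bYa orthonormal_or_zero_def)
      ultimately have "V.span (w ` {..<k}) \<subseteq> S" by (intro V.span_minimal)
      moreover have "w k \<notin> S"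
        using pos[OF k] v0[of k] by (simp add: S_def w_def bYa cinner_self)
      ultimately show "w k \<notin> V.span (w ` {..<k})" by blast
    qed
    then obtain e where e: "orthonormal_or_zero e" "\<And>k. k < n \<Longrightarrow> Re (cinner (M (e k)) (e k)) = s k"
      by blast
    define p q where "p k = fst (e k)" and "q k = snd (e k)" for k
    have pq: "(\<lambda>k. (p k, q k)) = e" by (simp add: p_def q_def)
    have "s k = Re (cinner (T (q k)) (p k))" if k: "k < n" for k
    proof -
      have "s k = Re (cinner (a (a (Y (q k)))) (p k)) + Re (cinner (b (b (adj Y (p k)))) (q k))"
        using e(2)[OF k] by (simp add: M_def cinner_prod_def p_def q_def)
      also have "Re (cinner (b (b (adj Y (p k)))) (q k)) = Re (cinner (p k) (Y (b (b (q k)))))"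
        by (simp add: selfadjointD[OF b(1)] cinner_adj'[OF lin_Y])
      also have "\<dots> = Re (cinner (Y (b (b (q k)))) (p k))" by (rule Re_cinner_commute)
      finally show ?thesis by (simp add: T_def blinfun.add_left cinner_add_left)
    qed
    then have "2 * (\<Sum>k<n. s k) = 2 * (\<Sum>k<n. Re (cinner (T (q k)) (p k)))" by simp
    also have "\<dots> \<le> (\<Sum>k<n. singular_values T k)"
      by (rule Ky_Fan_pairs[OF T]) (simp only: pq orthonormal_or_zero_bessel[OF e(1)])
    finally show ?thesis .
  qed
  have "2 * (\<Sum>k<n. s k) \<le> (\<Sum>k<n. singular_values T k)"
  proof (cases "\<exists>k<n. s k = 0")
    case False
    then show ?thesis using s(2) by (intro pos_case) (metis less_eq_real_def)
  next
    case True
    define m where "m = (LEAST k. s k = 0)"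
    have m: "s m = 0" "m < n"
      using True LeastI[of "\<lambda>k. s k = 0"] Least_le[of "\<lambda>k. s k = 0"] by (auto simp: m_def intro: le_less_trans)
    have "0 < s k" if "k < m" for k
      using not_less_Least[of k "\<lambda>k. s k = 0"] that s(2)[of k] by (auto simp: m_def less_eq_real_def)
    then have "2 * (\<Sum>k<m. s k) \<le> (\<Sum>k<m. singular_values T k)" by (rule pos_case)
    also have "(\<Sum>k<m. s k) = (\<Sum>k<n. s k)"
    proof (rule sum.mono_neutral_left)
      show "\<forall>k\<in>{..<n} - {..<m}. s k = 0"
        using decseqD[OF s(1), of m] m(1) s(2) by (auto intro: antisym)
    qed (use m in auto)
    also have "(\<Sum>k<m. singular_values T k) \<le> (\<Sum>k<n. singular_values T k)"
      using m(2) singular_values_decseq_nonneg(2)[OF T] by (intro sum_mono2) auto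
    finally show ?thesis .
  qed
  then show ?thesis by (simp add: s_def Z_def T_def)
qed


lemma arithmetic_geometric_mean_ui_norm:
  fixes a b Y :: "'a :: separable_hilbert \<Rightarrow>\<^sub>L 'a"
  assumes g: "symmetric_gauge g"
    and a: "selfadjoint a" "is_clinear a" and b: "selfadjoint b" "is_clinear b" and Y: "compact_op Y"
  shows "2 * ui_norm g (a o\<^sub>L Y o\<^sub>L b) \<le> ui_norm g ((a o\<^sub>L a o\<^sub>L Y) + (Y o\<^sub>L b o\<^sub>L b))"
proof -
  define Z where "Z = a o\<^sub>L Y o\<^sub>L b"
  define T where "T = (a o\<^sub>L a o\<^sub>L Y) + (Y o\<^sub>L b o\<^sub>L b)"
  have Z: "compact_op Z" unfolding Z_def by (intro compact_op_compose_right compact_op_compose_left a b Y)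
  have T: "compact_op T"
    unfolding T_def
    by (intro compact_op_add compact_op_compose_right compact_op_compose_left is_clinear_compose a b Y)
  have "ereal 2 * ui_norm g Z = gauge_ext g (\<lambda>k. 2 * singular_values Z k)"
    unfolding ui_norm_def by (rule gauge_ext_scale[OF g, symmetric]) simp
  also have "\<dots> \<le> ui_norm g T"
    unfolding ui_norm_def
  proof (rule Fan_dominance[OF g])
    show "decseq (\<lambda>k. 2 * singular_values Z k)"
      using singular_values_decseq_nonneg(1)[OF Z] by (simp add: decseq_def)
    show "(\<Sum>k<r. 2 * singular_values Z k) \<le> (\<Sum>k<r. singular_values T k)" for r
      using arithmetic_geometric_mean_partial_sums[OF a b Y, of r]
      by (simp add: sum_distrib_left[symmetric] Z_def T_def)
  qed (use singular_values_decseq_nonneg(2)[OF Z] singular_values_decseq_nonneg(2)[OF T] in auto)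
  finally show ?thesis by (simp add: Z_def T_def)
qed

section \<open>Convexity of the Heinz difference\<close>

text \<open>Let \<open>h\<close> be the difference of \<open>f\<close> and its chord, multiplied by \<open>b - a\<close>, and \<open>m\<close> its supremum. Every
  point of the interval is the midpoint of an end point, where \<open>h\<close> vanishes, and another point of the
  interval. Hence \<open>h \<le> m/2\<close>, so \<open>m \<le> m/2\<close> and \<open>m \<le> 0\<close>.\<close>

lemma midpoint_convex_bounded_le_chord:
  fixes f :: "real \<Rightarrow> real"
  assumes mid: "\<And>x y. x \<in> {a..b} \<Longrightarrow> y \<in> {a..b} \<Longrightarrow> 2 * f ((x + y) / 2) \<le> f x + f y"
    and bdd: "\<And>x. x \<in> {a..b} \<Longrightarrow> f x \<le> B" and x: "x \<in> {a..b}"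
  shows "(b - a) * f x \<le> (b - x) * f a + (x - a) * f b"
proof -
  define h where "h x = (b - a) * f x - (b - x) * f a - (x - a) * f b" for x
  have ab: "a \<le> b" using x by simp
  have h_mid: "2 * h ((x + y) / 2) \<le> h x + h y" if "x \<in> {a..b}" "y \<in> {a..b}" for x y
  proof -
    have "(b - a) * (2 * f ((x + y) / 2)) \<le> (b - a) * (f x + f y)"
      using mid[OF that] ab by (intro mult_left_mono) auto
    then show ?thesis by (simp add: h_def field_simps)
  qed
  have h_ends: "h a = 0" "h b = 0" by (simp_all add: h_def algebra_simps)
  have h_bdd: "bdd_above (h ` {a..b})"
  proof (rule bdd_aboveI2)
    fix x assume x: "x \<in> {a..b}"
    have "(b - a) * f x \<le> (b - a) * B" using bdd[OF x] ab by (intro mult_left_mono) auto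
    moreover have "- ((b - x) * f a) \<le> (b - a) * \<bar>f a\<bar>"
    proof -
      have "(b - x) * (- f a) \<le> (b - a) * \<bar>f a\<bar>" using x by (intro order_trans[OF mult_left_mono mult_right_mono]) auto
      then show ?thesis by simp
    qed
    moreover have "- ((x - a) * f b) \<le> (b - a) * \<bar>f b\<bar>"
    proof -
      have "(x - a) * (- f b) \<le> (b - a) * \<bar>f b\<bar>"
        using x by (intro order_trans[OF mult_left_mono mult_right_mono]) auto
      then show ?thesis by simp
    qed
    ultimately show "h x \<le> (b - a) * B + (b - a) * \<bar>f a\<bar> + (b - a) * \<bar>f b\<bar>"
      unfolding h_def by linarith
  qed
  define m where "m = Sup (h ` {a..b})"
  have h_le: "h x \<le> m" if "x \<in> {a..b}" for x
    unfolding m_def by (rule cSup_upper[OF _ h_bdd]) (use that in auto)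
  have half: "h x \<le> m / 2" if "x \<in> {a..b}" for x
  proof (cases "2 * x \<le> a + b")
    case True
    then show ?thesis using h_mid[of a "2 * x - a"] h_le[of "2 * x - a"] h_ends that ab by simp
  next
    case False
    then show ?thesis using h_mid[of "2 * x - b" b] h_le[of "2 * x - b"] h_ends that ab by simp
  qed
  have "m \<le> m / 2"
    unfolding m_def by (rule cSup_least) (use half ab in \<open>auto simp: m_def\<close>)
  then have "h x \<le> 0" using h_le[OF x] by linarith
  then show ?thesis by (simp add: h_def)
qed

context
  fixes g :: "(nat \<Rightarrow> real) \<Rightarrow> real" and A B X :: "'a :: separable_hilbert \<Rightarrow>\<^sub>L 'a"
  assumes g: "symmetric_gauge g" and A: "positive_op A" and B: "positive_op B"
    and X: "X \<in> norm_ideal g"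
begin

definition heinz_op :: "real \<Rightarrow> 'a \<Rightarrow>\<^sub>L 'a" where
  "heinz_op \<nu> = (op_powr A \<nu> o\<^sub>L X o\<^sub>L op_powr B (1 - \<nu>)) - (op_powr A (1 - \<nu>) o\<^sub>L X o\<^sub>L op_powr B \<nu>)"

lemma heinz_diff_eq: "heinz_diff g A B X \<nu> = ui_norm g (heinz_op \<nu>)"
  by (simp add: heinz_diff_def heinz_op_def)

lemma compact_X: "compact_op X" and finite_X: "ui_norm g X < \<infinity>"
  using X by (auto simp: norm_ideal_def)

lemma compact_term:
  assumes "0 \<le> r" "0 \<le> s"
  shows "compact_op (op_powr A r o\<^sub>L X o\<^sub>L op_powr B s)"
  by (intro compact_op_compose_right compact_op_compose_left compact_X
      op_powr_clinear[OF A] op_powr_clinear[OF B] assms)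

lemma compact_heinz_op: "0 \<le> \<nu> \<Longrightarrow> \<nu> \<le> 1 \<Longrightarrow> compact_op (heinz_op \<nu>)"
  unfolding heinz_op_def by (intro compact_op_diff compact_term) auto

lemma heinz_diff_symmetric: "0 \<le> \<nu> \<Longrightarrow> \<nu> \<le> 1 \<Longrightarrow> heinz_diff g A B X (1 - \<nu>) = heinz_diff g A B X \<nu>"
proof -
  assume "0 \<le> \<nu>" "\<nu> \<le> 1"
  then have "ui_norm g (- heinz_op \<nu>) = ui_norm g (heinz_op \<nu>)"
    by (intro ui_norm_uminus[OF g] compact_heinz_op)
  moreover have "heinz_op (1 - \<nu>) = - heinz_op \<nu>" by (simp add: heinz_op_def)
  ultimately show ?thesis by (simp add: heinz_diff_eq)
qed

lemma heinz_diff_half: "heinz_diff g A B X (1/2) = 0"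
  by (simp add: heinz_diff_eq heinz_op_def ui_norm_zero[OF g])

lemma heinz_diff_bounded:
  obtains C :: real where "\<And>\<nu>. 0 \<le> \<nu> \<Longrightarrow> \<nu> \<le> 1 \<Longrightarrow> heinz_diff g A B X \<nu> \<le> ereal C"
proof -
  obtain x where x: "ui_norm g X = ereal x"
    using finite_X ui_norm_nonneg[OF g, of X] by (cases "ui_norm g X") auto
  define c d where "c = max 1 (norm A)" and "d = max 1 (norm B)"
  have cd: "0 < c" "0 < d" by (auto simp: c_def d_def)
  have summand: "ui_norm g (op_powr A r o\<^sub>L X o\<^sub>L op_powr B s) \<le> ereal (c * d * x)"
    if "0 \<le> r" "r \<le> 1" "0 \<le> s" "s \<le> 1" for r s
  proof -
    have "ui_norm g (op_powr A r o\<^sub>L X o\<^sub>L op_powr B s) \<le> ereal (c * d) * ui_norm g X"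
      unfolding c_def d_def
      by (intro ui_norm_ideal[OF g] compact_X op_powr_clinear[OF A] op_powr_clinear[OF B]
          norm_op_powr_le[OF A] norm_op_powr_le[OF B] that cd[unfolded c_def d_def])
    then show ?thesis by (simp add: x)
  qed
  have "heinz_diff g A B X \<nu> \<le> ereal (c * d * x + c * d * x)" if \<nu>: "0 \<le> \<nu>" "\<nu> \<le> 1" for \<nu>
  proof -
    have "heinz_diff g A B X \<nu> \<le> ui_norm g (op_powr A \<nu> o\<^sub>L X o\<^sub>L op_powr B (1 - \<nu>)) +
        ui_norm g (- (op_powr A (1 - \<nu>) o\<^sub>L X o\<^sub>L op_powr B \<nu>))"
      unfolding heinz_diff_eq heinz_op_def diff_conv_add_uminus
      by (intro ui_norm_triangle[OF g] compact_op_uminus compact_term) (use \<nu> in auto)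
    also have "\<dots> \<le> ereal (c * d * x) + ereal (c * d * x)"
      using \<nu> by (intro add_mono summand) (auto simp: ui_norm_uminus[OF g compact_term] intro!: summand)
    finally show ?thesis by simp
  qed
  then show thesis by (rule that)
qed

text \<open>The mean inequality is applied with \<open>a = A\<^sup>\<delta>\<close> and \<open>b = B\<^sup>\<delta>\<close>, where \<open>\<delta>\<close> is half the distance of the two
  points; all exponents that occur are nonnegative because \<open>x\<close> and \<open>y\<close> lie in \<open>[0, 1]\<close>.\<close>

lemma heinz_diff_midpoint:
  assumes "0 \<le> x" "x \<le> y" "y \<le> 1"
  shows "2 * heinz_diff g A B X ((x + y) / 2) \<le> heinz_diff g A B X x + heinz_diff g A B X y"
proof -
  define \<delta> where "\<delta> = (y - x) / 2"
  define a b where "a = op_powr A \<delta>" and "b = op_powr B \<delta>"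
  define Y where "Y = (op_powr A x o\<^sub>L X o\<^sub>L op_powr B (1 - y)) - (op_powr A (1 - y) o\<^sub>L X o\<^sub>L op_powr B x)"
  have \<delta>: "0 \<le> \<delta>" using assms by (simp add: \<delta>_def)
  have addA: "op_powr A r (op_powr A s z) = op_powr A (r + s) z" if "0 \<le> r" "0 \<le> s" for r s z
    by (simp add: op_powr_add[OF A that])
  have addB: "op_powr B r (op_powr B s z) = op_powr B (r + s) z" if "0 \<le> r" "0 \<le> s" for r s z
    by (simp add: op_powr_add[OF B that])
  have Y: "compact_op Y" unfolding Y_def by (intro compact_op_diff compact_term) (use assms in auto)
  have mid: "heinz_op ((x + y) / 2) = a o\<^sub>L Y o\<^sub>L b"
  proof -
    have e: "\<delta> + x = (x + y) / 2" "1 - y + \<delta> = 1 - (x + y) / 2"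
      "\<delta> + (1 - y) = 1 - (x + y) / 2" "x + \<delta> = (x + y) / 2"
      by (simp_all add: \<delta>_def field_simps)
    show ?thesis
      by (rule blinfun_eqI)
        (use assms \<delta> in \<open>simp add: heinz_op_def Y_def a_def b_def blinfun.diff_left blinfun.diff_right
          addA addB e\<close>)
  qed
  have sum: "(a o\<^sub>L a o\<^sub>L Y) + (Y o\<^sub>L b o\<^sub>L b) = heinz_op x + heinz_op y"
  proof -
    have e: "\<delta> + (\<delta> + x) = y" "\<delta> + (\<delta> + (1 - y)) = 1 - x" "1 - y + (\<delta> + \<delta>) = 1 - x" "x + (\<delta> + \<delta>) = y"
      "1 - y + 2 * \<delta> = 1 - x" "x + 2 * \<delta> = y"
      by (simp_all add: \<delta>_def field_simps)
    show ?thesis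
      by (rule blinfun_eqI)
        (use assms \<delta> in \<open>simp add: heinz_op_def Y_def a_def b_def blinfun.diff_left blinfun.diff_right
          blinfun.add_left addA addB e\<close>)
  qed
  have "2 * ui_norm g (heinz_op ((x + y) / 2)) \<le> ui_norm g (heinz_op x + heinz_op y)"
    unfolding mid sum[symmetric] a_def b_def
    by (intro arithmetic_geometric_mean_ui_norm g Y op_powr_selfadjoint op_powr_clinear A B \<delta>)
  also have "\<dots> \<le> ui_norm g (heinz_op x) + ui_norm g (heinz_op y)"
    using assms by (intro ui_norm_triangle[OF g] compact_heinz_op) auto
  finally show ?thesis by (simp add: heinz_diff_eq)
qed

lemma heinz_diff_convex_real:
  obtains k :: "real \<Rightarrow> real"
  where "\<And>\<nu>. 0 \<le> \<nu> \<Longrightarrow> \<nu> \<le> 1 \<Longrightarrow> heinz_diff g A B X \<nu> = ereal (k \<nu>)"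
    and "\<And>a b x. 0 \<le> a \<Longrightarrow> a \<le> x \<Longrightarrow> x \<le> b \<Longrightarrow> b \<le> 1 \<Longrightarrow> (b - a) * k x \<le> (b - x) * k a + (x - a) * k b"
proof -
  obtain C where C: "\<And>\<nu>. 0 \<le> \<nu> \<Longrightarrow> \<nu> \<le> 1 \<Longrightarrow> heinz_diff g A B X \<nu> \<le> ereal C"
    by (rule heinz_diff_bounded) (rule that)
  define k where "k \<nu> = real_of_ereal (heinz_diff g A B X \<nu>)" for \<nu>
  have k: "heinz_diff g A B X \<nu> = ereal (k \<nu>)" if "0 \<le> \<nu>" "\<nu> \<le> 1" for \<nu>
    using C[OF that] ui_norm_nonneg[OF g, of "heinz_op \<nu>"]
    unfolding k_def heinz_diff_eq by (cases "ui_norm g (heinz_op \<nu>)") auto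
  have ordered: "2 * k ((x + y) / 2) \<le> k x + k y" if "0 \<le> x" "x \<le> y" "y \<le> 1" for x y
  proof -
    have "ereal 2 * ereal (k ((x + y) / 2)) \<le> ereal (k x) + ereal (k y)"
      using heinz_diff_midpoint[OF that] k[of x] k[of y] k[of "(x + y) / 2"] that by simp
    then show ?thesis by simp
  qed
  have midp: "2 * k ((x + y) / 2) \<le> k x + k y" if "x \<in> {0..1}" "y \<in> {0..1}" for x y
    using ordered[of x y] ordered[of y x] that by (cases "x \<le> y") (auto simp: add.commute)
  have k_le: "k \<nu> \<le> C" if "0 \<le> \<nu>" "\<nu> \<le> 1" for \<nu>
    using C[OF that] k[OF that] by simp
  have "(b - a) * k x \<le> (b - x) * k a + (x - a) * k b"
    if "0 \<le> a" "a \<le> x" "x \<le> b" "b \<le> 1" for a b x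
    using that by (intro midpoint_convex_bounded_le_chord[where B = C]) (auto intro!: midp k_le)
  then show thesis using k that by blast
qed

end

theorem theorem5p3:
  fixes g :: "(nat \<Rightarrow> real) \<Rightarrow> real"
    and A B X :: "'a :: separable_hilbert \<Rightarrow>\<^sub>L 'a"
    and \<nu> r0 lmin :: real
    and K :: "real \<Rightarrow> ereal"
  assumes "symmetric_gauge g"
    and "positive_op A" and "positive_op B"
    and "X \<in> norm_ideal g"
    and "1/4 \<le> \<nu>" and "\<nu> \<le> 3/4"
    and "r0 = min \<nu> (1 - \<nu>)"
    and "lmin = min (2 - 4 * r0) (4 * r0 - 1)"
    and "K = heinz_diff g A B X"
  shows "K \<nu> \<le> K \<nu> + ereal (2 * lmin) * (ereal (1/2) * K (1/4) - K (3/8))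
    \<and> K \<nu> + ereal (2 * lmin) * (ereal (1/2) * K (1/4) - K (3/8)) \<le> ereal (2 * (1 - 2 * r0)) * K (1/4)"
proof -
  obtain k where k: "\<And>\<nu>. 0 \<le> \<nu> \<Longrightarrow> \<nu> \<le> 1 \<Longrightarrow> K \<nu> = ereal (k \<nu>)"
    and conv: "\<And>a b x. 0 \<le> a \<Longrightarrow> a \<le> x \<Longrightarrow> x \<le> b \<Longrightarrow> b \<le> 1 \<Longrightarrow> (b - a) * k x \<le> (b - x) * k a + (x - a) * k b"
    by (rule heinz_diff_convex_real[OF assms(1-4), folded assms(9)]) (rule that)
  have r0: "1/4 \<le> r0" "r0 \<le> 1/2" using assms(5-7) by (auto simp: min_def)
  have "K \<nu> = K r0"
  proof (cases "r0 = \<nu>")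
    case False
    then have "r0 = 1 - \<nu>" using assms(7) by (auto simp: min_def split: if_splits)
    then show ?thesis
      using heinz_diff_symmetric[OF assms(1-4), of \<nu>] assms(5,6,9) by simp
  qed simp
  then have K\<nu>: "K \<nu> = ereal (k r0)" using k[of r0] r0 by simp
  have half: "k (1/2) = 0"
    using k[of "1/2"] heinz_diff_half[OF assms(1-4)] assms(9) by (simp add: zero_ereal_def)
  have mid: "k (3/8) \<le> k (1/4) / 2" using conv[of "1/4" "3/8" "1/2"] half by simp
  have lmin: "0 \<le> lmin" using r0 assms(8) by simp
  have lower: "0 \<le> 2 * lmin * (k (1/4) / 2 - k (3/8))" using mid lmin by simp
  \<comment> \<open>The two branches of \<open>lmin\<close> meet at \<open>3/8\<close>; on either side the chord contributes exactly
    \<open>2 * lmin * k (3/8)\<close>, which cancels.\<close>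
  have upper: "k r0 + 2 * lmin * (k (1/4) / 2 - k (3/8)) \<le> 2 * (1 - 2 * r0) * k (1/4)"
  proof (cases "r0 \<le> 3/8")
    case True
    then have l: "lmin = 4 * r0 - 1" using assms(8) by simp
    have "(3/8 - 1/4) * k r0 \<le> (3/8 - r0) * k (1/4) + (r0 - 1/4) * k (3/8)"
      using conv[of "1/4" r0 "3/8"] r0 True by simp
    then show ?thesis unfolding l by (simp add: field_simps)
  next
    case False
    then have l: "lmin = 2 - 4 * r0" using assms(8) by simp
    have "(1/2 - 3/8) * k r0 \<le> (1/2 - r0) * k (3/8) + (r0 - 3/8) * k (1/2)"
      using conv[of "3/8" r0 "1/2"] r0 False by simp
    then show ?thesis unfolding l half by (simp add: field_simps)
  qed
  show ?thesis using lower upper k[of "1/4"] k[of "3/8"] by (simp add: K\<nu>)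
qed

end
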